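(* Consider a translation-invariant IPS generator with single-site updates $$Lf(\eta)=\sum_{i\in\mathbb{Z}^d}\sum_{\xi_i=1,\dots,q}c_i(\eta,\xi_i)[f(\xi_i\eta_{i^c})-f(\eta)]$$ and semigroup $(P^L_t)_{t\ge0}$. Assume that (1) $L$ is finite range: there is a finite centered box $\Delta\Subset\mathbb{Z}^d$ such that for all $\xi_o\in\{1,\dots,q\}$, $c_o(\eta,\xi_o)=c_o(\eta_\Delta\sigma_{\Delta^c},\xi_o)$ for all $\eta,\sigma\in\Omega$; (2) reachability is independent of the boundary conditions: whenever $c_o(\eta,\xi_o)>0$, also $c_o(\sigma,\xi_o)>0$ for all $\sigma$ with $\sigma_o=\eta_o$; in this case we say that $\xi_o$ can be reached from $\eta_o$, and write $d(\eta_o,\xi_o)$ for the indicator of this event; (3) $L$ is single-site irreducible: the Markov chain on the single-site state space $\{1,\dots,q\}$ with rates given by $d$ is irreducible. Then, for all $\tau>0$ there exists $\delta=\delta(\tau)>0$ such that for any starting measure $\nu\in\mathcal{P}_\theta$ and any time $t\in[\tau,\infty)$, the time-evolved measure $\nu P^L_t$ is non-null with constant $\delta$. Furthermore, any subsequential weak limiting measure $\nu_*=\lim_{n\uparrow\infty}\nu P^L_{t_n}$, where $t_n\uparrow\infty$, is also non-null with constant $\delta$.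
   Context: Fix integers $d,q\ge1$; $\Omega=\{1,\dots,q\}^{\mathbb{Z}^d}$ with product topology and Borel $\sigma$-algebra; $\mathcal{P}_\theta$ is the set of translation-invariant probability measures on $\Omega$. $\Delta\Subset\mathbb{Z}^d$ means finite subset; $o$ is the origin; $i^c=\mathbb{Z}^d\setminus\{i\}$; $\eta_\Delta$ is the restriction of $\eta$ to $\Delta$ and juxtaposition such as $\xi_i\eta_{i^c}$ or $\eta_\Delta\sigma_{\Delta^c}$ denotes concatenation of configurations on disjoint sets. The rates $c_i(\eta,\xi_i)\ge0$ are continuous in $\eta$, and translation invariance of $L$ means that all rates are translation invariant. The closure of $L$ generates a Feller Markov semigroup $(P_t^L)_{t\ge0}$ on $C(\Omega)$, and $\nu P^L_t$ is the time-evolved measure. A probability measure $\nu$ on $\Omega$ is non-null with constant $\delta>0$ if there is a version of the single-site conditional probabilities such that for every $a\in\{1,\dots,q\}$, $\nu(\omega_o=a\,|\,\omega_{o^c})\ge\delta$ for $\nu$-a.a. $\omega$. *)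

theory Defs
  imports "HOL-Probability.Probability"
begin

text \<open>
  The lattice \<open>\<int>\<^sup>d\<close> is \<open>int ^ 'd\<close> with \<open>d = CARD('d)\<close>, and the single-site state space
  \<open>{1,\<dots>,q}\<close> is a finite type \<open>'s\<close> with \<open>q = CARD('s)\<close>; types are nonempty, so \<open>d, q \<ge> 1\<close>.
  Since \<open>'s\<close> is discrete, the function-space topology on configurations is the product
  topology, \<open>borel\<close> is its Borel \<open>\<sigma>\<close>-algebra, and, configurations forming a compact space,
  \<open>C(\<Omega>)\<close> is the Banach space of bounded continuous functions. The configuration
  \<open>\<xi>\<^sub>i \<eta>\<^bsub>i\<^sup>c\<^esub>\<close> is \<open>\<eta>(i := \<xi>)\<close>, and \<open>\<eta>\<^bsub>\<Delta>\<^esub> \<sigma>\<^bsub>\<Delta>\<^sup>c\<^esub>\<close> is \<open>override_on \<sigma> \<eta> \<Delta>\<close>.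
\<close>

type_synonym ('d, 's) config = "int ^ 'd \<Rightarrow> 's"

type_synonym ('d, 's) rates = "int ^ 'd \<Rightarrow> ('d, 's) config \<Rightarrow> 's \<Rightarrow> real"

type_synonym ('d, 's) observable = "('d, 's) config \<Rightarrow>\<^sub>C real"

definition shift :: "int ^ 'd \<Rightarrow> ('d::finite, 's) config \<Rightarrow> ('d, 's) config" where
  "shift k \<eta> = (\<lambda>i. \<eta> (i + k))"

definition prob_measures :: "('d::finite, 's::{finite, discrete_topology}) config measure set" where
  "prob_measures = {\<nu>. prob_space \<nu> \<and> sets \<nu> = sets borel}"

definition ti_measures :: "('d::finite, 's::{finite, discrete_topology}) config measure set" where
  "ti_measures = {\<nu> \<in> prob_measures. \<forall>k. distr \<nu> borel (shift k) = \<nu>}"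

definition ti_rates :: "('d::finite, 's::{finite, discrete_topology}) rates \<Rightarrow> bool" where
  "ti_rates c \<longleftrightarrow>
     (\<forall>i \<eta> a. 0 \<le> c i \<eta> a) \<and>
     (\<forall>i a. continuous_on UNIV (\<lambda>\<eta>. c i \<eta> a)) \<and>
     (\<forall>i k \<eta> a. c (i + k) \<eta> a = c i (shift k \<eta>) a)"

definition centered_box :: "nat \<Rightarrow> (int ^ 'd::finite) set" where
  "centered_box n = {i. \<forall>k. \<bar>i $ k\<bar> \<le> int n}"

definition finite_range :: "('d::finite, 's::{finite, discrete_topology}) rates \<Rightarrow> bool" where
  "finite_range c \<longleftrightarrow>
     (\<exists>n. \<forall>a \<eta> \<sigma>. c 0 \<eta> a = c 0 (override_on \<sigma> \<eta> (centered_box n)) a)"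

definition bc_independent_reachability ::
    "('d::finite, 's::{finite, discrete_topology}) rates \<Rightarrow> bool" where
  "bc_independent_reachability c \<longleftrightarrow>
     (\<forall>\<eta> a. c 0 \<eta> a > 0 \<longrightarrow> (\<forall>\<sigma>. \<sigma> 0 = \<eta> 0 \<longrightarrow> c 0 \<sigma> a > 0))"

definition reach_indicator ::
    "('d::finite, 's::{finite, discrete_topology}) rates \<Rightarrow> 's \<Rightarrow> 's \<Rightarrow> real" where
  "reach_indicator c a b = (if \<exists>\<eta>. \<eta> 0 = a \<and> c 0 \<eta> b > 0 then 1 else 0)"

definition irreducible_chain :: "('s \<Rightarrow> 's \<Rightarrow> real) \<Rightarrow> bool" where
  "irreducible_chain r \<longleftrightarrow> (\<forall>a b. (a, b) \<in> {(x, y). r x y > 0}\<^sup>*)"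

text \<open>
  The operator \<open>L\<close> is taken on local functions; for finite-range rates they have the same graph
  closure as the functions \<open>f\<close> with summable oscillations. For a local \<open>f\<close> only finitely many
  sites contribute to the sum.
\<close>

definition local_observable ::
    "('d::finite, 's::{finite, discrete_topology}) observable \<Rightarrow> bool" where
  "local_observable f \<longleftrightarrow>
     (\<exists>A. finite A \<and> (\<forall>\<eta> \<sigma>. (\<forall>i\<in>A. \<eta> i = \<sigma> i) \<longrightarrow> apply_bcontfun f \<eta> = apply_bcontfun f \<sigma>))"

definition ips_generator ::
    "('d::finite, 's::{finite, discrete_topology}) rates
      \<Rightarrow> (('d, 's) config \<Rightarrow> real) \<Rightarrow> ('d, 's) config \<Rightarrow> real" where
  "ips_generator c f \<eta> = (\<Sum>\<^sub>\<infinity>i. \<Sum>a\<in>UNIV. c i \<eta> a * (f (\<eta>(i := a)) - f \<eta>))"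

definition ips_graph ::
    "('d::finite, 's::{finite, discrete_topology}) rates
      \<Rightarrow> (('d, 's) observable \<times> ('d, 's) observable) set" where
  "ips_graph c =
     {(f, g). local_observable f \<and> apply_bcontfun g = ips_generator c (apply_bcontfun f)}"

text \<open>Only the operators \<open>P t\<close> with \<open>t \<ge> 0\<close> are constrained.\<close>

definition feller_semigroup ::
    "(real \<Rightarrow> ('d::finite, 's::{finite, discrete_topology}) observable \<Rightarrow> ('d, 's) observable)
      \<Rightarrow> bool" where
  "feller_semigroup P \<longleftrightarrow>
     (\<forall>t\<ge>0. linear (P t)) \<and>
     (\<forall>t\<ge>0. P t (const_bcontfun 1) = const_bcontfun 1) \<and>
     (\<forall>t\<ge>0. \<forall>f. (\<forall>\<eta>. 0 \<le> apply_bcontfun f \<eta>) \<longrightarrow> (\<forall>\<eta>. 0 \<le> apply_bcontfun (P t f) \<eta>)) \<and>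
     P 0 = id \<and>
     (\<forall>s\<ge>0. \<forall>t\<ge>0. P (s + t) = P s \<circ> P t) \<and>
     (\<forall>f. continuous_on {0..} (\<lambda>t. P t f))"

definition semigroup_generator_graph ::
    "(real \<Rightarrow> ('d::finite, 's::{finite, discrete_topology}) observable \<Rightarrow> ('d, 's) observable)
      \<Rightarrow> (('d, 's) observable \<times> ('d, 's) observable) set" where
  "semigroup_generator_graph P =
     {(f, g). ((\<lambda>t. (P t f - f) /\<^sub>R t) \<longlongrightarrow> g) (at_right 0)}"

definition ips_semigroup ::
    "('d::finite, 's::{finite, discrete_topology}) rates
      \<Rightarrow> (real \<Rightarrow> ('d, 's) observable \<Rightarrow> ('d, 's) observable) \<Rightarrow> bool" where
  "ips_semigroup c P \<longleftrightarrow>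
     feller_semigroup P \<and> semigroup_generator_graph P = closure (ips_graph c)"

text \<open>
  \<open>evolve P t \<nu>\<close> is the measure \<open>\<nu> P\<^sub>t\<close>. For a Feller semigroup and \<open>t \<ge> 0\<close> it exists and is
  unique by the Riesz representation theorem.
\<close>

definition evolve ::
    "(real \<Rightarrow> ('d::finite, 's::{finite, discrete_topology}) observable \<Rightarrow> ('d, 's) observable)
      \<Rightarrow> real \<Rightarrow> ('d, 's) config measure \<Rightarrow> ('d, 's) config measure" where
  "evolve P t \<nu> =
     (THE \<mu>. \<mu> \<in> prob_measures \<and>
        (\<forall>f. (\<integral>\<eta>. apply_bcontfun f \<eta> \<partial>\<mu>) = (\<integral>\<eta>. apply_bcontfun (P t f) \<eta> \<partial>\<nu>)))"

definition weak_limit ::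
    "(nat \<Rightarrow> ('d::finite, 's::{finite, discrete_topology}) config measure)
      \<Rightarrow> ('d, 's) config measure \<Rightarrow> bool" where
  "weak_limit \<mu> \<mu>' \<longleftrightarrow>
     (\<forall>f :: ('d, 's) observable.
        (\<lambda>n. \<integral>\<eta>. apply_bcontfun f \<eta> \<partial>\<mu> n) \<longlonglongrightarrow> (\<integral>\<eta>. apply_bcontfun f \<eta> \<partial>\<mu>'))"

text \<open>The \<open>\<sigma>\<close>-algebra generated by \<open>\<omega> \<mapsto> \<omega>\<^bsub>o\<^sup>c\<^esub>\<close>.\<close>

definition off_origin ::
    "('d::finite, 's::{finite, discrete_topology}) config measure" where
  "off_origin = vimage_algebra UNIV (\<lambda>\<omega>. restrict \<omega> (- {0})) (PiM (- {0}) (\<lambda>_. borel))"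

text \<open>
  A version of the single-site conditional probabilities: a probability vector
  \<open>(\<nu>(\<omega>\<^sub>o = a | \<omega>\<^bsub>o\<^sup>c\<^esub>))\<^sub>a\<close>, measurable in \<open>\<omega>\<^bsub>o\<^sup>c\<^esub>\<close>.
\<close>

definition single_site_version ::
    "('d::finite, 's::{finite, discrete_topology}) config measure
      \<Rightarrow> (('d, 's) config \<Rightarrow> 's pmf) \<Rightarrow> bool" where
  "single_site_version \<nu> \<kappa> \<longleftrightarrow>
     (\<forall>a. (\<lambda>\<omega>. pmf (\<kappa> \<omega>) a) \<in> borel_measurable off_origin \<and>
       (AE \<omega> in \<nu>. pmf (\<kappa> \<omega>) a = real_cond_exp \<nu> off_origin (indicator {\<omega>. \<omega> 0 = a}) \<omega>))"

definition non_null ::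
    "real \<Rightarrow> ('d::finite, 's::{finite, discrete_topology}) config measure \<Rightarrow> bool" where
  "non_null \<delta> \<nu> \<longleftrightarrow>
     \<nu> \<in> prob_measures \<and> \<delta> > 0 \<and>
     (\<exists>\<kappa>. single_site_version \<nu> \<kappa> \<and> (\<forall>a. AE \<omega> in \<nu>. pmf (\<kappa> \<omega>) a \<ge> \<delta>))"

end

theory Submission
  imports Defs
begin

text \<open>
  It suffices that, uniformly in \<open>t \<ge> \<tau>\<close>, inserting the spin \<open>a\<close> at the origin costs at most a factor:
  \<open>P\<^sub>t (1\<^bsub>{\<omega>\<^sub>o = a}\<^esub> g) \<ge> \<delta> P\<^sub>t g\<close> for every local \<open>g \<ge> 0\<close> that does not depend on \<open>\<omega>\<^sub>o\<close>. By the
  semigroup property only \<open>t = \<tau>\<close> matters, and \<open>P\<^sub>\<tau>\<close> is the limit of products of single-site steps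
  \<open>1 + h L\<^sub>i\<close>, swept \<open>\<tau>/h\<close> times through a large box.

  For such a product, replace the rates of the neighbours \<open>j\<close> of the origin by the minimal rate \<open>m\<close> on
  the reachable transitions, so that they no longer see \<open>\<omega>\<^sub>o\<close>. The origin then decouples, and
  irreducibility of its own chain gives \<open>P(1\<^bsub>{\<omega>\<^sub>o = a}\<^esub> g) \<ge> c W g\<close> with \<open>W\<close> the decoupled evolution.
  Conversely \<open>W g\<close> dominates, up to a constant, \<open>E[exp(\<alpha> N\<^sub>o - \<beta> \<Sum>\<^sub>j N\<^sub>j) g]\<close>, where \<open>N\<^sub>i\<close> counts the jumps at \<open>i\<close> and
  \<open>e\<^bsup>\<beta>\<^esup> = M/m\<close>: each jump of a neighbour pays for the rate it loses, and \<open>\<alpha>\<close> is arbitrary. Using both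
  bounds at an arbitrary site \<open>i\<close> and \<open>e\<^sup>x \<ge> x\<close> yields
  \<open>\<alpha> E[N\<^sub>i f] \<le> \<beta> \<Sum>\<^sub>j E[N\<^sub>j f] + \<Gamma> E[f]\<close> for every \<open>f \<ge> 0\<close>; with \<open>\<alpha>\<close> larger than \<open>\<beta>\<close> times the number of
  neighbours, maximising over \<open>i\<close> gives \<open>E[N\<^sub>i f] \<le> \<Gamma> E[f]\<close>. So the jump numbers stay bounded whatever
  the final configuration, and Jensen's inequality gives \<open>W g \<ge> c' E[g]\<close>.
\<close>

section \<open>Products of single-site steps\<close>

locale comparable_rates =
  fixes c :: "'v \<Rightarrow> ('v \<Rightarrow> 's::finite) \<Rightarrow> 's \<Rightarrow> real"
    and nbh :: "'v \<Rightarrow> 'v set"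
    and reach :: "'s \<Rightarrow> 's \<Rightarrow> bool"
    and m M :: real
    and L :: nat
  assumes m_pos: "0 < m" and m_le_M: "m \<le> M"
    and c_unreach: "\<not> reach (\<eta> i) b \<Longrightarrow> c i \<eta> b = 0"
    and c_reach: "reach (\<eta> i) b \<Longrightarrow> m \<le> c i \<eta> b"
    and c_le: "c i \<eta> b \<le> M"
    and c_cong: "(\<And>j. j \<in> nbh i \<Longrightarrow> \<eta> j = \<sigma> j) \<Longrightarrow> c i \<eta> b = c i \<sigma> b"
    and nbh_refl: "i \<in> nbh i"
    and nbh_sym: "j \<in> nbh i \<Longrightarrow> i \<in> nbh j"
    and finite_nbh: "finite (nbh i)"
    and card_nbh: "card (nbh i) \<le> L"
    and irreducible: "(x, y) \<in> {(x, y). reach x y}\<^sup>*"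
begin

definition rmax :: real where "rmax = real CARD('s) * M"

definition exit_rate :: "'v \<Rightarrow> ('v \<Rightarrow> 's) \<Rightarrow> real" where
  "exit_rate i \<eta> = (\<Sum>b\<in>UNIV. c i \<eta> b)"

definition site_step :: "real \<Rightarrow> 'v \<Rightarrow> (('v \<Rightarrow> 's) \<Rightarrow> real) \<Rightarrow> ('v \<Rightarrow> 's) \<Rightarrow> real" where
  "site_step h i u \<eta> = (1 - h * exit_rate i \<eta>) * u \<eta> + h * (\<Sum>b\<in>UNIV. c i \<eta> b * u (\<eta>(i := b)))"

definition sweep :: "real \<Rightarrow> 'v list \<Rightarrow> (('v \<Rightarrow> 's) \<Rightarrow> real) \<Rightarrow> ('v \<Rightarrow> 's) \<Rightarrow> real" where
  "sweep h xs = foldr (site_step h) xs"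

definition count_step ::
    "real \<Rightarrow> 'v \<Rightarrow> (('v \<Rightarrow> 's) \<Rightarrow> ('v \<Rightarrow> nat) \<Rightarrow> real) \<Rightarrow> ('v \<Rightarrow> 's) \<Rightarrow> ('v \<Rightarrow> nat) \<Rightarrow> real" where
  "count_step h i u \<eta> N = (1 - h * exit_rate i \<eta>) * u \<eta> N +
     h * (\<Sum>b\<in>UNIV. c i \<eta> b * u (\<eta>(i := b)) (N(i := Suc (N i))))"

definition count_sweep ::
    "real \<Rightarrow> 'v list \<Rightarrow> (('v \<Rightarrow> 's) \<Rightarrow> ('v \<Rightarrow> nat) \<Rightarrow> real) \<Rightarrow> ('v \<Rightarrow> 's) \<Rightarrow> ('v \<Rightarrow> nat) \<Rightarrow> real" where
  "count_sweep h xs = foldr (count_step h) xs"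

text \<open>
  In the notation of the introduction, \<open>low_sweep h k xs\<close> is \<open>W\<close> for the site \<open>k\<close> in place of the
  origin, \<open>spin_step h\<close> is the chain of that site alone, \<open>count_sweep\<close> is \<open>E\<close>, and \<open>tilt\<close> is
  the exponential weight.
\<close>

definition low_step :: "real \<Rightarrow> 'v \<Rightarrow> 'v \<Rightarrow> (('v \<Rightarrow> 's) \<Rightarrow> real) \<Rightarrow> ('v \<Rightarrow> 's) \<Rightarrow> real" where
  "low_step h k i g \<eta> =
     (if i = k then g \<eta>
      else if i \<in> nbh k
      then (1 - h * rmax) * g \<eta> + h * (\<Sum>b\<in>UNIV. if reach (\<eta> i) b then m * g (\<eta>(i := b)) else 0)
      else site_step h i g \<eta>)"

definition low_sweep :: "real \<Rightarrow> 'v \<Rightarrow> 'v list \<Rightarrow> (('v \<Rightarrow> 's) \<Rightarrow> real) \<Rightarrow> ('v \<Rightarrow> 's) \<Rightarrow> real" where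
  "low_sweep h k xs = foldr (low_step h k) xs"

definition spin_step :: "real \<Rightarrow> ('s \<Rightarrow> real) \<Rightarrow> 's \<Rightarrow> real" where
  "spin_step h \<phi> x = (1 - h * rmax) * \<phi> x + h * (\<Sum>b\<in>UNIV. if reach x b then m * \<phi> b else 0)"

definition tilt :: "real \<Rightarrow> real \<Rightarrow> 'v \<Rightarrow> ('v \<Rightarrow> nat) \<Rightarrow> real" where
  "tilt \<alpha> \<beta> k N = exp (\<alpha> * real (N k) - \<beta> * (\<Sum>j\<in>nbh k - {k}. real (N j)))"

lemma sweep_simps [simp]:
  "sweep h [] u = u" "sweep h (i # xs) u = site_step h i (sweep h xs u)"
  by (simp_all add: sweep_def)

lemma count_sweep_simps [simp]:
  "count_sweep h [] w = w" "count_sweep h (i # xs) w = count_step h i (count_sweep h xs w)"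
  by (simp_all add: count_sweep_def)

lemma low_sweep_simps [simp]:
  "low_sweep h k [] u = u" "low_sweep h k (i # xs) u = low_step h k i (low_sweep h k xs u)"
  by (simp_all add: low_sweep_def)

lemma M_pos: "0 < M"
  using m_pos m_le_M by simp

lemma rmax_pos: "0 < rmax"
  using M_pos by (simp add: rmax_def)

lemma c_nonneg: "0 \<le> c i \<eta> b"
  using c_unreach[of \<eta> i b] c_reach[of \<eta> i b] m_pos by (cases "reach (\<eta> i) b") auto

lemma exit_rate_nonneg: "0 \<le> exit_rate i \<eta>"
  by (simp add: exit_rate_def sum_nonneg c_nonneg)

lemma exit_rate_le: "exit_rate i \<eta> \<le> rmax"
  using sum_bounded_above[of UNIV "c i \<eta>" M] c_le by (simp add: exit_rate_def rmax_def)

lemma holding_ge: "0 \<le> h \<Longrightarrow> 1 - h * rmax \<le> 1 - h * exit_rate i \<eta>"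
  by (simp add: exit_rate_le mult_left_mono)

lemma tilt_count:
  "tilt \<alpha> \<beta> k (N(i := Suc (N i))) =
     (if i = k then exp \<alpha> else if i \<in> nbh k then exp (- \<beta>) else 1) * tilt \<alpha> \<beta> k N"
proof -
  have "(\<Sum>j\<in>nbh k - {k}. real ((N(i := Suc (N i))) j)) =
    (\<Sum>j\<in>nbh k - {k}. real (N j)) + (if i \<in> nbh k - {k} then 1 else 0)"
  proof (cases "i \<in> nbh k - {k}")
    case True
    have "(\<Sum>j\<in>nbh k - {k}. real ((N(i := Suc (N i))) j)) =
      (\<Sum>j\<in>nbh k - {k}. real (N j) + (if j = i then 1 else 0))"
      by (intro sum.cong) auto
    also have "\<dots> = (\<Sum>j\<in>nbh k - {k}. real (N j)) + 1"
      using True finite_nbh by (simp add: sum.distrib)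
    finally show ?thesis using True by simp
  next
    case False
    then have "(\<Sum>j\<in>nbh k - {k}. real ((N(i := Suc (N i))) j)) = (\<Sum>j\<in>nbh k - {k}. real (N j))"
      by (intro sum.cong) auto
    then show ?thesis using False by (simp only: if_False)
  qed
  then show ?thesis
    by (auto simp: tilt_def exp_add[symmetric] algebra_simps)
qed

lemma tilt_pos: "0 < tilt \<alpha> \<beta> k N"
  by (simp add: tilt_def)

lemma count_step_mono:
  assumes "0 \<le> h" "h * rmax \<le> 1" "\<And>\<eta> N. u \<eta> N \<le> w \<eta> N"
  shows "count_step h i u \<eta> N \<le> count_step h i w \<eta> N"
  unfolding count_step_def
  using assms holding_ge[of h i \<eta>]
  by (intro add_mono mult_left_mono sum_mono c_nonneg) auto

lemma count_sweep_mono: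
  assumes "0 \<le> h" "h * rmax \<le> 1" "\<And>\<eta> N. u \<eta> N \<le> w \<eta> N"
  shows "count_sweep h xs u \<eta> N \<le> count_sweep h xs w \<eta> N"
  using assms by (induction xs arbitrary: \<eta> N) (auto intro: count_step_mono)

lemma count_step_add:
  "count_step h i (\<lambda>\<eta> N. u \<eta> N + w \<eta> N) \<eta> N = count_step h i u \<eta> N + count_step h i w \<eta> N"
  by (simp add: count_step_def algebra_simps sum.distrib)

lemma count_step_cmult:
  "count_step h i (\<lambda>\<eta> N. a * u \<eta> N) \<eta> N = a * count_step h i u \<eta> N"
  by (simp add: count_step_def algebra_simps sum_distrib_left)

lemma count_sweep_add:
  "count_sweep h xs (\<lambda>\<eta> N. u \<eta> N + w \<eta> N) \<eta> N = count_sweep h xs u \<eta> N + count_sweep h xs w \<eta> N"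
proof (induction xs arbitrary: \<eta> N)
  case (Cons i xs)
  have "count_sweep h xs (\<lambda>\<eta> N. u \<eta> N + w \<eta> N) =
      (\<lambda>\<eta> N. count_sweep h xs u \<eta> N + count_sweep h xs w \<eta> N)"
    using Cons by (intro ext)
  then show ?case by (simp add: count_step_add)
qed simp

lemma count_sweep_cmult:
  "count_sweep h xs (\<lambda>\<eta> N. a * u \<eta> N) \<eta> N = a * count_sweep h xs u \<eta> N"
proof (induction xs arbitrary: \<eta> N)
  case (Cons i xs)
  have "count_sweep h xs (\<lambda>\<eta> N. a * u \<eta> N) = (\<lambda>\<eta> N. a * count_sweep h xs u \<eta> N)"
    using Cons by (intro ext)
  then show ?case by (simp add: count_step_cmult)
qed simp

lemma count_sweep_sum:
  "finite A \<Longrightarrow> count_sweep h xs (\<lambda>\<eta> N. \<Sum>a\<in>A. u a \<eta> N) \<eta> N = (\<Sum>a\<in>A. count_sweep h xs (u a) \<eta> N)"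
proof (induction A rule: finite_induct)
  case empty
  then show ?case using count_sweep_cmult[of h xs 0 "\<lambda>\<eta> N. 0"] by simp
qed (simp add: count_sweep_add)

lemma count_sweep_no_count: "count_sweep h xs (\<lambda>\<eta> N. u \<eta>) \<eta> N = sweep h xs u \<eta>"
proof (induction xs arbitrary: \<eta> N)
  case (Cons i xs)
  have "count_sweep h xs (\<lambda>\<eta> N. u \<eta>) = (\<lambda>\<eta> N. sweep h xs u \<eta>)"
    using Cons by (intro ext)
  then show ?case by (simp add: count_step_def site_step_def)
qed simp

lemma count_sweep_unvisited:
  "j \<notin> set xs \<Longrightarrow> N j = 0 \<Longrightarrow> count_sweep h xs (\<lambda>\<eta> N. f \<eta> * real (N j)) \<eta> N = 0"
  by (induction xs arbitrary: \<eta> N) (auto simp: count_step_def)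

lemma sweep_mono:
  assumes "0 \<le> h" "h * rmax \<le> 1" "\<And>\<eta>. u \<eta> \<le> w \<eta>"
  shows "sweep h xs u \<eta> \<le> sweep h xs w \<eta>"
  using count_sweep_mono[of h "\<lambda>\<eta> N. u \<eta>" "\<lambda>\<eta> N. w \<eta>" xs \<eta>] assms
  by (simp add: count_sweep_no_count)

lemma sweep_cmult: "sweep h xs (\<lambda>\<eta>. a * u \<eta>) \<eta> = a * sweep h xs u \<eta>"
  using count_sweep_cmult[of h xs a "\<lambda>\<eta> N. u \<eta>" \<eta>] by (simp add: count_sweep_no_count)

lemma sweep_nonneg:
  assumes "0 \<le> h" "h * rmax \<le> 1" "\<And>\<eta>. 0 \<le> u \<eta>"
  shows "0 \<le> sweep h xs u \<eta>"
  using sweep_mono[of h "\<lambda>\<eta>. 0" u xs \<eta>] sweep_cmult[of h xs 0 u \<eta>] assms by simp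

lemma sweep_sum:
  "finite A \<Longrightarrow> sweep h xs (\<lambda>\<eta>. \<Sum>a\<in>A. u a \<eta>) \<eta> = (\<Sum>a\<in>A. sweep h xs (u a) \<eta>)"
  using count_sweep_sum[of A h xs "\<lambda>a \<eta> N. u a \<eta>" \<eta>] by (simp add: count_sweep_no_count)

lemma site_step_nonneg:
  assumes "0 \<le> h" "h * rmax \<le> 1" "\<And>\<eta>. 0 \<le> u \<eta>"
  shows "0 \<le> site_step h i u \<eta>"
  using sweep_nonneg[of h u "[i]"] assms by simp

definition free_of :: "'v \<Rightarrow> (('v \<Rightarrow> 's) \<Rightarrow> real) \<Rightarrow> bool" where
  "free_of k g \<longleftrightarrow> (\<forall>\<eta> x. g (\<eta>(k := x)) = g \<eta>)"

lemma c_upd: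
  assumes "k \<notin> nbh i" shows "c i (\<eta>(k := x)) b = c i \<eta> b"
  using assms by (intro c_cong) auto

lemma free_of_low_step:
  assumes "free_of k g" shows "free_of k (low_step h k i g)"
proof -
  have g: "g (\<eta>(k := x, i := b)) = g (\<eta>(i := b))" if "i \<noteq> k" for \<eta> x b
    using assms that by (metis fun_upd_twist free_of_def)
  have g0: "g (\<eta>(k := x)) = g \<eta>" for \<eta> x using assms by (simp add: free_of_def)
  show ?thesis unfolding free_of_def
  proof (intro allI)
    fix \<eta> x
    consider "i = k" | "i \<noteq> k" "i \<in> nbh k" | "i \<noteq> k" "k \<notin> nbh i" using nbh_sym by blast
    then show "low_step h k i g (\<eta>(k := x)) = low_step h k i g \<eta>"
      by cases (auto simp: low_step_def g g0 c_upd site_step_def exit_rate_def dest: nbh_sym cong: if_cong)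
  qed
qed

lemma low_step_nonneg:
  assumes "0 \<le> h" "h * rmax \<le> 1" "\<And>\<eta>. 0 \<le> g \<eta>"
  shows "0 \<le> low_step h k i g \<eta>"
  using assms m_pos
  by (auto simp: low_step_def intro!: site_step_nonneg add_nonneg_nonneg mult_nonneg_nonneg sum_nonneg)

lemma low_sweep_props:
  assumes "0 \<le> h" "h * rmax \<le> 1" "\<And>\<eta>. 0 \<le> g \<eta>" "free_of k g"
  shows "free_of k (low_sweep h k xs g)" and "0 \<le> low_sweep h k xs g \<eta>"
proof -
  show "free_of k (low_sweep h k xs g)"
    by (induction xs) (auto simp: assms intro: free_of_low_step)
  show "0 \<le> low_sweep h k xs g \<eta>"
    by (induction xs arbitrary: \<eta>) (auto simp: assms intro: low_step_nonneg)
qed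

lemma count_step_upper:
  assumes h: "0 \<le> h" "h * rmax \<le> 1/2"
    and \<alpha>: "0 \<le> \<alpha>" and \<beta>: "exp (- \<beta>) * M \<le> m"
    and g: "\<And>\<eta>. 0 \<le> g \<eta>" "free_of k g" and C: "0 \<le> C"
    and u: "\<And>\<eta> N. u \<eta> N \<le> C * (tilt \<alpha> \<beta> k N * g \<eta>)"
  shows "count_step h i u \<eta> N \<le>
    C * exp (if i \<in> nbh k then 2 * h * exp \<alpha> * rmax else 0) * (tilt \<alpha> \<beta> k N * low_step h k i g \<eta>)"
proof -
  define t where "t = tilt \<alpha> \<beta> k N"
  define w where "w = (if i = k then exp \<alpha> else if i \<in> nbh k then exp (- \<beta>) else 1)"
  have t: "0 \<le> t" using tilt_pos[of \<alpha> \<beta> k N] by (simp add: t_def)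
  have hold: "0 \<le> 1 - h * exit_rate i \<eta>" using holding_ge[of h i \<eta>] h by simp
  have "count_step h i u \<eta> N \<le> count_step h i (\<lambda>\<eta> N. C * (tilt \<alpha> \<beta> k N * g \<eta>)) \<eta> N"
    using h u by (intro count_step_mono) auto
  also have "\<dots> = C * t * ((1 - h * exit_rate i \<eta>) * g \<eta> +
      h * (\<Sum>b\<in>UNIV. w * (c i \<eta> b * g (\<eta>(i := b)))))"
    by (simp add: count_step_def tilt_count w_def t_def algebra_simps sum_distrib_left)
  finally have 1: "count_step h i u \<eta> N \<le> C * t * ((1 - h * exit_rate i \<eta>) * g \<eta> +
      h * (\<Sum>b\<in>UNIV. w * (c i \<eta> b * g (\<eta>(i := b)))))" .
  have 2: "(1 - h * exit_rate i \<eta>) * g \<eta> + h * (\<Sum>b\<in>UNIV. w * (c i \<eta> b * g (\<eta>(i := b))))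
    \<le> exp (if i \<in> nbh k then 2 * h * exp \<alpha> * rmax else 0) * low_step h k i g \<eta>"
  proof -
    have el: "1 \<le> exp \<alpha>" using \<alpha> by simp
    have hr: "0 \<le> h * rmax" using h rmax_pos by simp
    consider (a) "i = k" | (b) "i \<noteq> k" "i \<in> nbh k" | (c) "i \<noteq> k" "i \<notin> nbh k" by blast
    then show ?thesis
    proof cases
      case a
      have gk: "g (\<eta>(k := b)) = g \<eta>" for b using g(2) by (simp add: free_of_def)
      have "(1 - h * exit_rate i \<eta>) * g \<eta> + h * (\<Sum>b\<in>UNIV. w * (c i \<eta> b * g (\<eta>(i := b))))
        = (1 - h * exit_rate i \<eta> + h * exp \<alpha> * exit_rate i \<eta>) * g \<eta>"
        using a by (simp add: gk w_def exit_rate_def algebra_simps sum_distrib_left sum_distrib_right)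
      also have "\<dots> \<le> (1 + 2 * h * exp \<alpha> * rmax) * g \<eta>"
      proof (intro mult_right_mono g)
        have "h * exp \<alpha> * exit_rate i \<eta> \<le> h * exp \<alpha> * rmax"
          using h by (intro mult_left_mono exit_rate_le) auto
        moreover have "0 \<le> h * exp \<alpha> * rmax" using h rmax_pos by simp
        moreover have "0 \<le> h * exit_rate i \<eta>" using h exit_rate_nonneg by simp
        ultimately show "1 - h * exit_rate i \<eta> + h * exp \<alpha> * exit_rate i \<eta> \<le> 1 + 2 * h * exp \<alpha> * rmax"
          by linarith
      qed
      also have "\<dots> \<le> exp (2 * h * exp \<alpha> * rmax) * g \<eta>"
        by (intro mult_right_mono g exp_ge_add_one_self)
      finally show ?thesis using a by (simp add: low_step_def nbh_refl)
    next
      case b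
      define S where "S = (\<Sum>b\<in>UNIV. if reach (\<eta> i) b then m * g (\<eta>(i := b)) else 0)"
      have S: "0 \<le> S" using m_pos g by (auto simp: S_def intro!: sum_nonneg)
      have "(\<Sum>b\<in>UNIV. w * (c i \<eta> b * g (\<eta>(i := b)))) \<le> S"
        unfolding S_def
      proof (intro sum_mono)
        fix x
        have "exp (- \<beta>) * c i \<eta> x \<le> m"
          using \<beta> c_le[of i \<eta> x] by (meson exp_ge_zero mult_left_mono order_trans)
        then have "exp (- \<beta>) * c i \<eta> x * g (\<eta>(i := x)) \<le> m * g (\<eta>(i := x))"
          by (intro mult_right_mono g)
        then show "w * (c i \<eta> x * g (\<eta>(i := x))) \<le> (if reach (\<eta> i) x then m * g (\<eta>(i := x)) else 0)"
          using b c_unreach[of \<eta> i x] by (auto simp: w_def mult.assoc)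
      qed
      then have "(1 - h * exit_rate i \<eta>) * g \<eta> + h * (\<Sum>b\<in>UNIV. w * (c i \<eta> b * g (\<eta>(i := b))))
        \<le> 1 * g \<eta> + h * S"
        using h g exit_rate_nonneg[of i \<eta>] by (intro add_mono mult_right_mono mult_left_mono) auto
      also have "\<dots> \<le> (1 + 2 * (h * rmax)) * ((1 - h * rmax) * g \<eta> + h * S)"
      proof -
        have "1 \<le> (1 + 2 * (h * rmax)) * (1 - h * rmax)"
        proof -
          have "0 \<le> (h * rmax) * (1 - 2 * (h * rmax))" using h hr rmax_pos by (intro mult_nonneg_nonneg) auto
          then show ?thesis by (simp add: algebra_simps)
        qed
        then have "1 * g \<eta> \<le> ((1 + 2 * (h * rmax)) * (1 - h * rmax)) * g \<eta>"
          by (intro mult_right_mono g)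
        moreover have "1 * (h * S) \<le> (1 + 2 * (h * rmax)) * (h * S)"
          using hr h S rmax_pos by (intro mult_right_mono) auto
        ultimately show ?thesis by (simp add: algebra_simps)
      qed
      also have "\<dots> = (1 + 2 * (h * rmax)) * low_step h k i g \<eta>"
        using b by (simp add: low_step_def S_def)
      also have "\<dots> \<le> exp (2 * h * exp \<alpha> * rmax) * low_step h k i g \<eta>"
      proof (intro mult_right_mono)
        have "h * rmax * 1 \<le> h * rmax * exp \<alpha>" using el hr by (intro mult_left_mono)
        then have "1 + 2 * (h * rmax) \<le> 1 + 2 * h * exp \<alpha> * rmax" by (simp add: algebra_simps)
        then show "1 + 2 * (h * rmax) \<le> exp (2 * h * exp \<alpha> * rmax)"
          using exp_ge_add_one_self[of "2 * h * exp \<alpha> * rmax"] by linarith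
        show "0 \<le> low_step h k i g \<eta>" using h g by (intro low_step_nonneg) auto
      qed
      finally show ?thesis using b by simp
    next
      case c
      then show ?thesis by (simp add: low_step_def w_def site_step_def)
    qed
  qed
  have "count_step h i u \<eta> N \<le> C * t * (exp (if i \<in> nbh k then 2 * h * exp \<alpha> * rmax else 0) * low_step h k i g \<eta>)"
    using 1 mult_left_mono[OF 2, of "C * t"] C t by (auto intro: order_trans)
  then show ?thesis by (simp add: t_def mult.assoc mult.left_commute)
qed

lemma count_sweep_upper:
  assumes h: "0 \<le> h" "h * rmax \<le> 1/2"
    and \<alpha>: "0 \<le> \<alpha>" and \<beta>: "exp (- \<beta>) * M \<le> m"
    and g: "\<And>\<eta>. 0 \<le> g \<eta>" "free_of k g" and f: "\<And>\<eta>. f \<eta> \<le> g \<eta>"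
  shows "count_sweep h xs (\<lambda>\<eta> N. f \<eta> * tilt \<alpha> \<beta> k N) \<eta> N \<le>
    exp (2 * h * exp \<alpha> * rmax * real (length (filter (\<lambda>i. i \<in> nbh k) xs))) *
      (tilt \<alpha> \<beta> k N * low_sweep h k xs g \<eta>)"
proof (induction xs arbitrary: \<eta> N)
  case Nil
  then show ?case using f tilt_pos[of \<alpha> \<beta> k N] by (simp add: mult_right_mono mult.commute)
next
  case (Cons i xs)
  have "count_sweep h (i # xs) (\<lambda>\<eta> N. f \<eta> * tilt \<alpha> \<beta> k N) \<eta> N
    \<le> exp (2 * h * exp \<alpha> * rmax * real (length (filter (\<lambda>i. i \<in> nbh k) xs))) *
      exp (if i \<in> nbh k then 2 * h * exp \<alpha> * rmax else 0) *
      (tilt \<alpha> \<beta> k N * low_step h k i (low_sweep h k xs g) \<eta>)"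
    unfolding count_sweep_simps
    using h by (intro count_step_upper[OF h \<alpha> \<beta> _ _ _ Cons.IH] low_sweep_props g) auto
  then show ?case
    by (auto simp: exp_add[symmetric] algebra_simps split: if_splits)
qed

lemma spin_step_nonneg:
  assumes "0 \<le> h" "h * rmax \<le> 1" "\<And>x. 0 \<le> \<phi> x" shows "0 \<le> spin_step h \<phi> x"
  using assms m_pos by (auto simp: spin_step_def intro!: add_nonneg_nonneg mult_nonneg_nonneg sum_nonneg)

lemma spin_pow_nonneg:
  assumes "0 \<le> h" "h * rmax \<le> 1" "\<And>x. 0 \<le> \<phi> x" shows "0 \<le> (spin_step h ^^ n) \<phi> x"
  using assms by (induction n arbitrary: x) (auto intro: spin_step_nonneg)

lemma site_step_lower:
  assumes h: "0 \<le> h" "h * rmax \<le> 1"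
    and g: "\<And>\<eta>. 0 \<le> g \<eta>" "free_of k g" and \<phi>: "\<And>x. 0 \<le> \<phi> x"
    and u: "\<And>\<eta>. \<phi> (\<eta> k) * g \<eta> \<le> u \<eta>"
  shows "(if i = k then spin_step h \<phi> else \<phi>) (\<eta> k) * low_step h k i g \<eta> \<le> site_step h i u \<eta>"
proof -
  have "site_step h i (\<lambda>\<eta>. \<phi> (\<eta> k) * g \<eta>) \<eta> \<le> site_step h i u \<eta>"
    using sweep_mono[of h "\<lambda>\<eta>. \<phi> (\<eta> k) * g \<eta>" u "[i]"] h u by simp
  moreover have "(if i = k then spin_step h \<phi> else \<phi>) (\<eta> k) * low_step h k i g \<eta>
    \<le> site_step h i (\<lambda>\<eta>. \<phi> (\<eta> k) * g \<eta>) \<eta>"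
  proof -
    consider (a) "i = k" | (b) "i \<noteq> k" "i \<in> nbh k" | (c) "i \<noteq> k" "i \<notin> nbh k" by blast
    then show ?thesis
    proof cases
      case a
      have gk: "g (\<eta>(k := b)) = g \<eta>" for b using g(2) by (simp add: free_of_def)
      have "spin_step h \<phi> (\<eta> k) * g \<eta> = (1 - h * rmax) * (\<phi> (\<eta> k) * g \<eta>) +
          h * (\<Sum>b\<in>UNIV. (if reach (\<eta> k) b then m * \<phi> b * g \<eta> else 0))"
        by (simp add: spin_step_def algebra_simps sum_distrib_left if_distrib cong: if_cong)
      also have "\<dots> \<le> (1 - h * exit_rate k \<eta>) * (\<phi> (\<eta> k) * g \<eta>) +
          h * (\<Sum>b\<in>UNIV. c k \<eta> b * (\<phi> b * g \<eta>))"
      proof (intro add_mono mult_right_mono mult_left_mono sum_mono holding_ge)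
        fix b
        show "(if reach (\<eta> k) b then m * \<phi> b * g \<eta> else 0) \<le> c k \<eta> b * (\<phi> b * g \<eta>)"
          using c_reach[of \<eta> k b] c_nonneg[of k \<eta> b] \<phi> g(1)
          by (auto simp: mult.assoc intro!: mult_right_mono)
      qed (use h \<phi> g in auto)
      finally show ?thesis using a by (simp add: site_step_def low_step_def gk)
    next
      case b
      have "\<phi> (\<eta> k) * low_step h k i g \<eta> = (1 - h * rmax) * (\<phi> (\<eta> k) * g \<eta>) +
          h * (\<Sum>b\<in>UNIV. (if reach (\<eta> i) b then m * (\<phi> (\<eta> k) * g (\<eta>(i := b))) else 0))"
        using b by (simp add: low_step_def algebra_simps sum_distrib_left if_distrib cong: if_cong)
      also have "\<dots> \<le> (1 - h * exit_rate i \<eta>) * (\<phi> (\<eta> k) * g \<eta>) +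
          h * (\<Sum>b\<in>UNIV. c i \<eta> b * (\<phi> (\<eta> k) * g (\<eta>(i := b))))"
      proof (intro add_mono mult_right_mono mult_left_mono sum_mono holding_ge)
        fix b
        show "(if reach (\<eta> i) b then m * (\<phi> (\<eta> k) * g (\<eta>(i := b))) else 0)
          \<le> c i \<eta> b * (\<phi> (\<eta> k) * g (\<eta>(i := b)))"
          using c_reach[of \<eta> i b] c_nonneg[of i \<eta> b] \<phi> g(1)
          by (auto intro!: mult_right_mono)
      qed (use h \<phi> g in auto)
      finally show ?thesis using b by (simp add: site_step_def)
    next
      case c
      then show ?thesis
        by (simp add: low_step_def site_step_def algebra_simps sum_distrib_left)
    qed
  qed
  ultimately show ?thesis by linarith
qed

lemma sweep_lower:
  assumes h: "0 \<le> h" "h * rmax \<le> 1"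
    and g: "\<And>\<eta>. 0 \<le> g \<eta>" "free_of k g" and \<phi>: "\<And>x. 0 \<le> \<phi> x"
  shows "(spin_step h ^^ count_list xs k) \<phi> (\<eta> k) * low_sweep h k xs g \<eta>
    \<le> sweep h xs (\<lambda>\<eta>. \<phi> (\<eta> k) * g \<eta>) \<eta>"
proof (induction xs arbitrary: \<eta>)
  case (Cons i xs)
  show ?case
    using site_step_lower[OF h low_sweep_props(2)[OF h g, of xs] low_sweep_props(1)[OF h g, of xs]
        spin_pow_nonneg[OF h \<phi>] Cons.IH, where \<eta> = \<eta> and i = i]
    by (auto split: if_splits)
qed simp


lemma spin_pow_lower:
  assumes h: "0 \<le> h" "h * rmax \<le> 1" and xa: "(x, a) \<in> {(x, y). reach x y} ^^ k"
  shows "real (n choose k) * (1 - h * rmax) ^ n * (h * m) ^ k \<le> (spin_step h ^^ n) (indicator {a}) x"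
  using xa
proof (induction n arbitrary: x k)
  case 0
  then show ?case by (cases k) auto
next
  case (Suc n)
  let ?\<phi> = "(spin_step h ^^ n) (indicator {a})"
  have \<phi>: "0 \<le> ?\<phi> y" for y using h by (intro spin_pow_nonneg) auto
  have r: "0 \<le> 1 - h * rmax" "1 - h * rmax \<le> 1" using h rmax_pos by auto
  show ?case
  proof (cases k)
    case 0
    then have "(1 - h * rmax) * (1 - h * rmax) ^ n \<le> (1 - h * rmax) * ?\<phi> x"
      using Suc.IH[OF Suc.prems] r by (intro mult_left_mono) auto
    also have "\<dots> \<le> spin_step h ?\<phi> x"
      using h m_pos \<phi> by (auto simp: spin_step_def intro!: mult_nonneg_nonneg sum_nonneg)
    finally show ?thesis using 0 by simp
  next
    case (Suc l)
    obtain y where y: "reach x y" "(y, a) \<in> {(x, y). reach x y} ^^ l"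
      using relpow_Suc_D2[of x a l "{(x, y). reach x y}"] Suc.prems Suc by blast
    have "real (n choose k) * (1 - h * rmax) ^ n * (h * m) ^ k * (1 - h * rmax) +
        h * (m * (real (n choose l) * (1 - h * rmax) ^ n * (h * m) ^ l * 1))
      \<le> (1 - h * rmax) * ?\<phi> x + h * (m * ?\<phi> y)"
      using Suc.IH[OF Suc.prems] Suc.IH[OF y(2)] r h m_pos
      by (intro add_mono mult_left_mono) (auto simp: mult.commute[of _ "1 - h * rmax"] intro: mult_left_mono)
    also have "\<dots> \<le> spin_step h ?\<phi> x"
      unfolding spin_step_def[of h ?\<phi> x]
      using h y m_pos \<phi> member_le_sum[of y UNIV "\<lambda>b. if reach x b then m * ?\<phi> b else 0"]
      by (intro add_left_mono mult_left_mono) auto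
    finally have 1: "real (n choose k) * (1 - h * rmax) ^ n * (h * m) ^ k * (1 - h * rmax) +
        h * (m * (real (n choose l) * (1 - h * rmax) ^ n * (h * m) ^ l * 1)) \<le> spin_step h ?\<phi> x" .
    have "h * (m * (real (n choose l) * (1 - h * rmax) ^ n * (h * m) ^ l * (1 - h * rmax)))
       \<le> h * (m * (real (n choose l) * (1 - h * rmax) ^ n * (h * m) ^ l * 1))"
      using r h m_pos by (intro mult_left_mono) auto
    with 1 show ?thesis using Suc by (simp add: algebra_simps)
  qed
qed

lemma exp_le_one_minus:
  assumes "0 \<le> x" "x \<le> 1/2" shows "exp (- (2 * x)) \<le> 1 - (x::real)"
proof -
  have "x * x \<le> x * (1/2)" using assms by (intro mult_left_mono) auto
  then have "- (2 * x) \<le> ln (1 - x)"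
    using ln_one_minus_pos_lower_bound[of x] assms by (simp add: power2_eq_square)
  then show ?thesis using assms by (simp add: ln_ge_iff)
qed

lemma spin_pow_bounded_below:
  assumes \<tau>: "0 < \<tau>"
  shows "\<exists>\<delta>>0. \<forall>\<^sub>F n in sequentially. \<forall>x a. \<delta> \<le> (spin_step (\<tau> / real n) ^^ n) (indicator {a}) x"
proof -
  have "\<exists>\<delta>>0. \<forall>\<^sub>F n in sequentially. \<delta> \<le> (spin_step (\<tau> / real n) ^^ n) (indicator {a}) x" for x a
  proof -
    obtain k where k: "(x, a) \<in> {(x, y). reach x y} ^^ k"
      using irreducible[of x a] by (auto dest: rtrancl_imp_relpow)
    define N where "N = max (Suc k) (nat \<lceil>2 * \<tau> * rmax\<rceil>)"
    have "(\<tau> * m / real k) ^ k * exp (- (2 * \<tau> * rmax)) \<le> (spin_step (\<tau> / real n) ^^ n) (indicator {a}) x"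
      if "N \<le> n" for n
    proof -
      define h where "h = \<tau> / real n"
      have n: "0 < n" "k \<le> n" "2 * \<tau> * rmax \<le> real n" using that by (auto simp: N_def)
      have h: "0 \<le> h" "h * rmax \<le> 1/2" using \<tau> n by (auto simp: h_def field_simps)
      have "exp (- (2 * \<tau> * rmax)) = exp (- (2 * (h * rmax))) ^ n"
        using n by (simp add: h_def exp_of_nat_mult[symmetric])
      also have "\<dots> \<le> (1 - h * rmax) ^ n"
        using h rmax_pos by (intro power_mono exp_le_one_minus) auto
      finally have 1: "exp (- (2 * \<tau> * rmax)) \<le> (1 - h * rmax) ^ n" .
      have "(\<tau> * m / real k) ^ k = (real n / real k) ^ k * (h * m) ^ k"
        using n by (simp add: h_def power_mult_distrib[symmetric])
      also have "\<dots> \<le> real (n choose k) * (h * m) ^ k"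
        using h m_pos n by (intro mult_right_mono binomial_ge_n_over_k_pow_k) auto
      finally have "(\<tau> * m / real k) ^ k * exp (- (2 * \<tau> * rmax))
          \<le> real (n choose k) * (h * m) ^ k * (1 - h * rmax) ^ n"
        using 1 h m_pos by (intro mult_mono mult_nonneg_nonneg zero_le_power) auto
      also have "\<dots> \<le> (spin_step h ^^ n) (indicator {a}) x"
        using spin_pow_lower[of h x a k n] h k by (simp add: mult_ac)
      finally show ?thesis by (simp add: h_def)
    qed
    moreover have "0 < (\<tau> * m / real k) ^ k * exp (- (2 * \<tau> * rmax))"
      using \<tau> m_pos by (cases "k = 0") auto
    ultimately show ?thesis by (auto simp: eventually_sequentially)
  qed
  then have "\<forall>p. \<exists>\<delta>. 0 < \<delta> \<and>
      (\<forall>\<^sub>F n in sequentially. \<delta> \<le> (spin_step (\<tau> / real n) ^^ n) (indicator {snd p}) (fst p))"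
    by blast
  from choice[OF this] obtain \<delta> where \<delta>: "\<And>p. 0 < \<delta> p"
    "\<And>p. \<forall>\<^sub>F n in sequentially. \<delta> p \<le> (spin_step (\<tau> / real n) ^^ n) (indicator {snd p}) (fst p)"
    by blast
  have "\<forall>\<^sub>F n in sequentially. \<forall>p. \<delta> p \<le> (spin_step (\<tau> / real n) ^^ n) (indicator {snd p}) (fst p)"
    by (intro eventually_all_finite \<delta>)
  then have "\<forall>\<^sub>F n in sequentially. \<forall>x a. Min (range \<delta>) \<le> (spin_step (\<tau> / real n) ^^ n) (indicator {a}) x"
  proof eventually_elim
    case (elim n)
    show ?case
    proof (intro allI)
      fix x a
      have "Min (range \<delta>) \<le> \<delta> (x, a)" by (intro Min_le) auto
      also have "\<dots> \<le> (spin_step (\<tau> / real n) ^^ n) (indicator {a}) x"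
        using elim[rule_format, of "(x, a)"] by simp
      finally show "Min (range \<delta>) \<le> (spin_step (\<tau> / real n) ^^ n) (indicator {a}) x" .
    qed
  qed
  moreover have "0 < Min (range \<delta>)" using \<delta>(1) by (subst Min_gr_iff) auto
  ultimately show ?thesis by blast
qed

lemma free_of_upd: "free_of k (\<lambda>\<eta>. f (\<eta>(k := a)))"
  by (simp add: free_of_def)

context
  fixes h \<tau> \<delta>0 :: real and n :: nat and xs :: "'v list"
  assumes h: "0 \<le> h" "h * rmax \<le> 1/2" and \<delta>0: "0 < \<delta>0"
    and visits: "\<And>i. real (length (filter (\<lambda>j. j \<in> nbh i) xs)) * h \<le> \<tau> * real L"
    and count: "\<And>i. i \<in> set xs \<Longrightarrow> count_list xs i = n"
    and spin: "\<And>x a. \<delta>0 \<le> (spin_step h ^^ n) (indicator {a}) x"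
begin

lemma visit_exp_le:
  "exp (2 * h * exp \<alpha> * rmax * real (length (filter (\<lambda>i. i \<in> nbh k) xs)))
    \<le> exp (2 * \<tau> * real L * exp \<alpha> * rmax)"
  using mult_left_mono[OF visits[of k], of "2 * exp \<alpha> * rmax"] rmax_pos by (simp add: algebra_simps)

lemma sweep_indicator_lower:
  assumes "k \<in> set xs" "\<And>\<eta>. 0 \<le> g \<eta>" "free_of k g"
  shows "\<delta>0 * low_sweep h k xs g \<eta> \<le> sweep h xs (\<lambda>\<eta>. indicator {a} (\<eta> k) * g \<eta>) \<eta>"
proof -
  have "\<delta>0 * low_sweep h k xs g \<eta> \<le> (spin_step h ^^ count_list xs k) (indicator {a}) (\<eta> k) * low_sweep h k xs g \<eta>"
    using h assms spin count by (intro mult_right_mono low_sweep_props) auto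
  also have "\<dots> \<le> sweep h xs (\<lambda>\<eta>. indicator {a} (\<eta> k) * g \<eta>) \<eta>"
    using h assms by (intro sweep_lower) auto
  finally show ?thesis .
qed

lemma tilt_moment_le:
  assumes k: "k \<in> set xs" and f: "\<And>\<eta>. 0 \<le> f \<eta>" and \<alpha>: "0 \<le> \<alpha>" and \<beta>: "exp (- \<beta>) * M \<le> m"
  shows "count_sweep h xs (\<lambda>\<eta> N. f \<eta> * tilt \<alpha> \<beta> k N) \<eta> (\<lambda>_. 0)
    \<le> exp (2 * \<tau> * real L * exp \<alpha> * rmax) / \<delta>0 * sweep h xs f \<eta>"
proof -
  define g where "g = (\<lambda>a \<eta>. f (\<eta>(k := a)))"
  define \<Gamma> where "\<Gamma> = exp (2 * \<tau> * real L * exp \<alpha> * rmax)"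
  have g: "0 \<le> g a \<eta>" "free_of k (g a)" for a \<eta>
    using f by (auto simp: g_def free_of_upd)
  have split: "f \<eta> = (\<Sum>a\<in>UNIV. indicator {a} (\<eta> k) * g a \<eta>)" for \<eta>
  proof -
    have "(\<Sum>a\<in>UNIV. indicator {a} (\<eta> k) * g a \<eta>) = (\<Sum>a\<in>UNIV. if a = \<eta> k then g a \<eta> else 0)"
      by (intro sum.cong) (auto simp: indicator_def)
    then show ?thesis by (simp add: g_def)
  qed
  have "count_sweep h xs (\<lambda>\<eta> N. indicator {a} (\<eta> k) * g a \<eta> * tilt \<alpha> \<beta> k N) \<eta> (\<lambda>_. 0)
      \<le> \<Gamma> / \<delta>0 * sweep h xs (\<lambda>\<eta>. indicator {a} (\<eta> k) * g a \<eta>) \<eta>" for a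
  proof -
    have "count_sweep h xs (\<lambda>\<eta> N. indicator {a} (\<eta> k) * g a \<eta> * tilt \<alpha> \<beta> k N) \<eta> (\<lambda>_. 0)
      \<le> exp (2 * h * exp \<alpha> * rmax * real (length (filter (\<lambda>i. i \<in> nbh k) xs))) *
        (tilt \<alpha> \<beta> k (\<lambda>_. 0) * low_sweep h k xs (g a) \<eta>)"
      using g by (intro count_sweep_upper h \<alpha> \<beta>) (auto simp: indicator_def)
    also have "\<dots> \<le> \<Gamma> * low_sweep h k xs (g a) \<eta>"
      using visit_exp_le[of \<alpha> k] h g
      by (auto simp: tilt_def \<Gamma>_def intro!: mult_right_mono low_sweep_props)
    also have "\<dots> \<le> \<Gamma> * (sweep h xs (\<lambda>\<eta>. indicator {a} (\<eta> k) * g a \<eta>) \<eta> / \<delta>0)"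
      using sweep_indicator_lower[OF k g, of a \<eta> a] \<delta>0
      by (intro mult_left_mono) (auto simp: \<Gamma>_def field_simps)
    finally show ?thesis by simp
  qed
  then have "(\<Sum>a\<in>UNIV. count_sweep h xs (\<lambda>\<eta> N. indicator {a} (\<eta> k) * g a \<eta> * tilt \<alpha> \<beta> k N) \<eta> (\<lambda>_. 0))
      \<le> (\<Sum>a\<in>UNIV. \<Gamma> / \<delta>0 * sweep h xs (\<lambda>\<eta>. indicator {a} (\<eta> k) * g a \<eta>) \<eta>)"
    by (intro sum_mono)
  also have "\<dots> = \<Gamma> / \<delta>0 * sweep h xs f \<eta>"
    by (simp only: sweep_sum[OF finite, symmetric] sum_distrib_left[symmetric] split[symmetric])
  also have "(\<Sum>a\<in>UNIV. count_sweep h xs (\<lambda>\<eta> N. indicator {a} (\<eta> k) * g a \<eta> * tilt \<alpha> \<beta> k N) \<eta> (\<lambda>_. 0))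
      = count_sweep h xs (\<lambda>\<eta> N. f \<eta> * tilt \<alpha> \<beta> k N) \<eta> (\<lambda>_. 0)"
    by (simp only: count_sweep_sum[OF finite, symmetric] sum_distrib_right[symmetric] split[symmetric])
  finally show ?thesis by (simp add: \<Gamma>_def)
qed

lemma count_moment_le:
  assumes f: "\<And>\<eta>. 0 \<le> f \<eta>" and \<beta>: "0 \<le> \<beta>" "exp (- \<beta>) * M \<le> m"
  shows "count_sweep h xs (\<lambda>\<eta> N. f \<eta> * real (N i)) \<eta> (\<lambda>_. 0)
    \<le> exp (2 * \<tau> * real L * exp (\<beta> * real L + 1) * rmax) / \<delta>0 * sweep h xs f \<eta>"
proof -
  define \<alpha> where "\<alpha> = \<beta> * real L + 1"
  define \<Gamma> where "\<Gamma> = exp (2 * \<tau> * real L * exp \<alpha> * rmax) / \<delta>0"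
  define e where "e = (\<lambda>i. count_sweep h xs (\<lambda>\<eta> N. f \<eta> * real (N i)) \<eta> (\<lambda>_. 0))"
  have sf: "0 \<le> sweep h xs f \<eta>" using h f by (intro sweep_nonneg) auto
  have e_nonneg: "0 \<le> e i" for i
    using count_sweep_mono[of h "\<lambda>\<eta> N. 0" "\<lambda>\<eta> N. f \<eta> * real (N i)" xs \<eta> "\<lambda>_. 0"] h f
      count_sweep_cmult[of h xs 0 "\<lambda>\<eta> N. 0" \<eta> "\<lambda>_. 0"]
    by (simp add: e_def)
  have e_unvisited: "e i = 0" if "i \<notin> set xs" for i
    unfolding e_def using that by (intro count_sweep_unvisited) auto
  have \<Gamma>: "0 \<le> \<Gamma>" using \<delta>0 by (simp add: \<Gamma>_def)
  have key: "\<alpha> * e k - \<beta> * (\<Sum>j\<in>nbh k - {k}. e j) \<le> \<Gamma> * sweep h xs f \<eta>" if k: "k \<in> set xs" for k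
  proof -
    have "\<alpha> * e k - \<beta> * (\<Sum>j\<in>nbh k - {k}. e j) = \<alpha> * e k + (- \<beta>) * (\<Sum>j\<in>nbh k - {k}. e j)" by simp
    also have "\<dots> = count_sweep h xs (\<lambda>\<eta> N. \<alpha> * (f \<eta> * real (N k)) +
        (- \<beta>) * (\<Sum>j\<in>nbh k - {k}. f \<eta> * real (N j))) \<eta> (\<lambda>_. 0)"
      by (simp only: count_sweep_add count_sweep_cmult e_def count_sweep_sum[OF finite_Diff[OF finite_nbh]])
    also have "\<dots> = count_sweep h xs (\<lambda>\<eta> N. f \<eta> * (\<alpha> * real (N k) - \<beta> * (\<Sum>j\<in>nbh k - {k}. real (N j)))) \<eta> (\<lambda>_. 0)"
      by (simp add: algebra_simps sum_distrib_left sum_negf)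
    also have "\<dots> \<le> count_sweep h xs (\<lambda>\<eta> N. f \<eta> * tilt \<alpha> \<beta> k N) \<eta> (\<lambda>_. 0)"
    proof (intro count_sweep_mono mult_left_mono f)
      fix N :: "'v \<Rightarrow> nat"
      show "\<alpha> * real (N k) - \<beta> * (\<Sum>j\<in>nbh k - {k}. real (N j)) \<le> tilt \<alpha> \<beta> k N"
        unfolding tilt_def
        using exp_ge_add_one_self[of "\<alpha> * real (N k) - \<beta> * (\<Sum>j\<in>nbh k - {k}. real (N j))"] by linarith
    qed (use h in auto)
    also have "\<dots> \<le> \<Gamma> * sweep h xs f \<eta>"
      unfolding \<Gamma>_def using k f \<beta> by (intro tilt_moment_le) (auto simp: \<alpha>_def)
    finally show ?thesis .
  qed
  have "e i \<le> \<Gamma> * sweep h xs f \<eta>"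
  proof (cases "i \<in> set xs")
    case False
    then show ?thesis using e_unvisited sf \<Gamma> by simp
  next
    case True
    then have "Max (e ` set xs) \<in> e ` set xs" by (intro Max_in) auto
    then obtain k where "k \<in> set xs" "e k = Max (e ` set xs)" by fastforce
    then have k: "k \<in> set xs" "\<And>j. j \<in> set xs \<Longrightarrow> e j \<le> e k" by auto
    have le: "e j \<le> e k" for j
      using k e_unvisited[of j] e_nonneg[of k] by (cases "j \<in> set xs") auto
    have "(\<Sum>j\<in>nbh k - {k}. e j) \<le> real (card (nbh k - {k})) * e k"
      using le by (intro sum_bounded_above) auto
    also have "\<dots> \<le> real L * e k"
      using card_nbh[of k] e_nonneg[of k] card_Diff_subset[of "{k}" "nbh k"]
        card_mono[OF finite_nbh, of "nbh k - {k}" k]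
      by (intro mult_right_mono) auto
    finally have "\<beta> * (\<Sum>j\<in>nbh k - {k}. e j) \<le> \<beta> * (real L * e k)"
      using \<beta> by (intro mult_left_mono)
    with key[OF k(1)] have "e k \<le> \<Gamma> * sweep h xs f \<eta>"
      by (simp add: \<alpha>_def algebra_simps)
    then show ?thesis using le[of i] by simp
  qed
  then show ?thesis by (simp add: e_def \<Gamma>_def \<alpha>_def)
qed

lemma sweep_non_null:
  assumes k: "k \<in> set xs" and g: "\<And>\<eta>. 0 \<le> g \<eta>" "free_of k g"
    and \<beta>: "0 \<le> \<beta>" "exp (- \<beta>) * M \<le> m"
    and E: "E = exp (2 * \<tau> * real L * exp (\<beta> * real L + 1) * rmax)"
  shows "\<delta>0 / E * exp (- (\<beta> * real L * E / \<delta>0)) * sweep h xs g \<eta>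
    \<le> sweep h xs (\<lambda>\<eta>. indicator {a} (\<eta> k) * g \<eta>) \<eta>"
proof -
  define s where "s = \<beta> * real L * E / \<delta>0"
  define \<alpha> where "\<alpha> = \<beta> * real L + 1"
  define A where "A = nbh k - {k}"
  have E_pos: "0 < E" by (simp add: E)
  have sg: "0 \<le> sweep h xs g \<eta>" using h g by (intro sweep_nonneg) auto
  define e where "e = (\<lambda>i. count_sweep h xs (\<lambda>\<eta> N. g \<eta> * real (N i)) \<eta> (\<lambda>_. 0))"
  have "(\<Sum>j\<in>A. e j) \<le> real (card A) * (E / \<delta>0 * sweep h xs g \<eta>)"
    unfolding e_def E using g \<beta> by (intro sum_bounded_above count_moment_le) auto
  also have "\<dots> \<le> real L * (E / \<delta>0 * sweep h xs g \<eta>)"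
    using card_nbh[of k] card_mono[OF finite_nbh, of A k] sg E_pos \<delta>0
    by (intro mult_right_mono) (auto simp: A_def)
  finally have "\<beta> * (\<Sum>j\<in>A. e j) \<le> \<beta> * (real L * (E / \<delta>0 * sweep h xs g \<eta>))"
    using \<beta> by (intro mult_left_mono)
  also have "\<dots> = s * sweep h xs g \<eta>" by (simp add: s_def)
  finally have se: "\<beta> * (\<Sum>j\<in>A. e j) \<le> s * sweep h xs g \<eta>" .
  have "exp (- s) * sweep h xs g \<eta> \<le> exp (- s) * ((1 + s) * sweep h xs g \<eta> + (- \<beta>) * (\<Sum>j\<in>A. e j))"
    using se by (simp add: algebra_simps)
  also have "(1 + s) * sweep h xs g \<eta> + (- \<beta>) * (\<Sum>j\<in>A. e j) =
      count_sweep h xs (\<lambda>\<eta> N. (1 + s) * g \<eta> + (- \<beta>) * (\<Sum>j\<in>A. g \<eta> * real (N j))) \<eta> (\<lambda>_. 0)"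
    by (simp only: count_sweep_add count_sweep_cmult e_def count_sweep_no_count
        count_sweep_sum[OF finite_Diff[OF finite_nbh]] A_def)
  also have "exp (- s) * \<dots> = count_sweep h xs
      (\<lambda>\<eta> N. g \<eta> * (exp (- s) * (1 + (s - \<beta> * (\<Sum>j\<in>A. real (N j)))))) \<eta> (\<lambda>_. 0)"
    by (simp add: count_sweep_cmult[symmetric] algebra_simps sum_distrib_left sum_negf)
  also have "\<dots> \<le> count_sweep h xs (\<lambda>\<eta> N. g \<eta> * tilt \<alpha> \<beta> k N) \<eta> (\<lambda>_. 0)"
  proof (intro count_sweep_mono mult_left_mono g)
    fix N :: "'v \<Rightarrow> nat"
    have "exp (- s) * (1 + (s - \<beta> * (\<Sum>j\<in>A. real (N j))))
        \<le> exp (- s) * exp (s - \<beta> * (\<Sum>j\<in>A. real (N j)))"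
      by (intro mult_left_mono exp_ge_add_one_self) auto
    also have "\<dots> = exp (- \<beta> * (\<Sum>j\<in>A. real (N j)))" by (simp add: exp_add[symmetric])
    also have "\<dots> \<le> tilt \<alpha> \<beta> k N"
      using \<beta> by (auto simp: tilt_def A_def \<alpha>_def)
    finally show "exp (- s) * (1 + (s - \<beta> * (\<Sum>j\<in>A. real (N j)))) \<le> tilt \<alpha> \<beta> k N" .
  qed (use h in auto)
  also have "\<dots> \<le> exp (2 * h * exp \<alpha> * rmax * real (length (filter (\<lambda>i. i \<in> nbh k) xs))) *
        (tilt \<alpha> \<beta> k (\<lambda>_. 0) * low_sweep h k xs g \<eta>)"
    using g h \<beta> by (intro count_sweep_upper) (auto simp: \<alpha>_def)
  also have "\<dots> \<le> E * low_sweep h k xs g \<eta>"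
    using visit_exp_le[of \<alpha> k] h g
    by (auto simp: tilt_def E \<alpha>_def intro!: mult_right_mono low_sweep_props)
  also have "\<dots> \<le> E * (sweep h xs (\<lambda>\<eta>. indicator {a} (\<eta> k) * g \<eta>) \<eta> / \<delta>0)"
    using sweep_indicator_lower[OF k g, of \<eta> a] \<delta>0 E_pos
    by (intro mult_left_mono) (auto simp: field_simps)
  finally have "exp (- s) * sweep h xs g \<eta> \<le> E * (sweep h xs (\<lambda>\<eta>. indicator {a} (\<eta> k) * g \<eta>) \<eta> / \<delta>0)" .
  then have "\<delta>0 / E * (exp (- s) * sweep h xs g \<eta>) \<le>
      \<delta>0 / E * (E * (sweep h xs (\<lambda>\<eta>. indicator {a} (\<eta> k) * g \<eta>) \<eta> / \<delta>0))"
    using \<delta>0 E_pos by (intro mult_left_mono) auto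
  then show ?thesis using E_pos \<delta>0 by (simp add: s_def mult.assoc)
qed

end

end

definition depends_on :: "'v set \<Rightarrow> (('v \<Rightarrow> 's) \<Rightarrow> 'b) \<Rightarrow> bool" where
  "depends_on A u \<longleftrightarrow> (\<forall>\<eta> \<sigma>. (\<forall>i\<in>A. \<eta> i = \<sigma> i) \<longrightarrow> u \<eta> = u \<sigma>)"

lemma depends_on_mono: "depends_on A u \<Longrightarrow> A \<subseteq> B \<Longrightarrow> depends_on B u"
  unfolding depends_on_def by (meson subsetD)

lemma depends_on_upd: "depends_on A u \<Longrightarrow> i \<notin> A \<Longrightarrow> u (\<eta>(i := x)) = u \<eta>"
  unfolding depends_on_def by (metis fun_upd_other)

context comparable_rates
begin

definition site_gen :: "'v \<Rightarrow> (('v \<Rightarrow> 's) \<Rightarrow> real) \<Rightarrow> ('v \<Rightarrow> 's) \<Rightarrow> real" where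
  "site_gen i u \<eta> = (\<Sum>b\<in>UNIV. c i \<eta> b * (u (\<eta>(i := b)) - u \<eta>))"

lemma site_step_eq: "site_step h i u \<eta> = u \<eta> + h * site_gen i u \<eta>"
  by (simp add: site_step_def site_gen_def exit_rate_def algebra_simps sum_subtractf sum_distrib_left)

lemma site_gen_bound:
  assumes "\<And>b. \<bar>u (\<eta>(i := b)) - u \<eta>\<bar> \<le> d"
  shows "\<bar>site_gen i u \<eta>\<bar> \<le> rmax * d"
proof -
  have d: "0 \<le> d" using assms[of undefined] by linarith
  have "\<bar>site_gen i u \<eta>\<bar> \<le> (\<Sum>b\<in>UNIV. \<bar>c i \<eta> b * (u (\<eta>(i := b)) - u \<eta>)\<bar>)"
    unfolding site_gen_def by (rule sum_abs)
  also have "\<dots> \<le> (\<Sum>b\<in>(UNIV::'s set). M * d)"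
    using assms c_le c_nonneg M_pos by (intro sum_mono) (auto simp: abs_mult intro!: mult_mono)
  finally show ?thesis by (simp add: rmax_def)
qed

lemma site_gen_bound_sup:
  assumes "\<And>\<eta>. \<bar>u \<eta>\<bar> \<le> C"
  shows "\<bar>site_gen i u \<eta>\<bar> \<le> 2 * rmax * C"
proof -
  have "\<bar>u (\<eta>(i := b)) - u \<eta>\<bar> \<le> 2 * C" for b :: 's
    using assms[of "\<eta>(i := b)"] assms[of \<eta>] by linarith
  from site_gen_bound[of u \<eta> i, OF this] show ?thesis by simp
qed

lemma site_gen_outside:
  assumes "depends_on A u" "i \<notin> A" shows "site_gen i u \<eta> = 0"
  using depends_on_upd[OF assms] by (simp add: site_gen_def)

lemma depends_on_site_gen:
  assumes "depends_on A u" shows "depends_on (A \<union> nbh i) (site_gen i u)"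
  unfolding depends_on_def
proof (intro allI impI)
  fix \<eta> \<sigma> :: "'v \<Rightarrow> 's" assume eq: "\<forall>j\<in>A \<union> nbh i. \<eta> j = \<sigma> j"
  have "u (\<eta>(i := b)) = u (\<sigma>(i := b))" "u \<eta> = u \<sigma>" for b
    using assms eq unfolding depends_on_def by auto
  moreover have "c i \<eta> b = c i \<sigma> b" for b using eq by (intro c_cong) auto
  ultimately show "site_gen i u \<eta> = site_gen i u \<sigma>" by (simp add: site_gen_def)
qed

lemma depends_on_site_step:
  assumes "depends_on A u" shows "depends_on (A \<union> nbh i) (site_step h i u)"
  using depends_on_site_gen[OF assms, of i] depends_on_mono[OF assms, of "A \<union> nbh i"]
  unfolding depends_on_def site_step_eq by (metis sup_ge1)

lemma depends_on_sweep:
  assumes "depends_on A u" "\<And>i. i \<in> set xs \<Longrightarrow> nbh i \<subseteq> A" shows "depends_on A (sweep h xs u)"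
  using assms(2)
proof (induction xs)
  case (Cons i xs)
  then have "depends_on A (sweep h xs u)" and i: "A \<union> nbh i = A" by auto
  from depends_on_site_step[OF this(1), of i] show ?case by (simp add: i)
qed (simp add: assms)

lemma sweep_const: "sweep h xs (\<lambda>_. a) \<eta> = a"
proof (induction xs arbitrary: \<eta>)
  case (Cons i xs)
  then have "sweep h xs (\<lambda>_. a) = (\<lambda>_. a)" by (intro ext)
  then show ?case by (simp add: site_step_eq site_gen_def)
qed simp

lemma sweep_bound:
  assumes h: "0 \<le> h" "h * rmax \<le> 1" and u: "\<And>\<eta>. \<bar>u \<eta>\<bar> \<le> C"
  shows "\<bar>sweep h xs u \<eta>\<bar> \<le> C"
  using sweep_mono[OF h, of u "\<lambda>_. C" xs \<eta>] sweep_mono[OF h, of "\<lambda>_. - C" u xs \<eta>] u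
  by (auto simp: sweep_const abs_le_iff minus_le_iff)

lemma sweep_append: "sweep h (xs @ ys) u = sweep h xs (sweep h ys u)"
  by (simp add: sweep_def)

lemma sweep_replicate: "sweep h (concat (replicate n xs)) u = (sweep h xs ^^ n) u"
  by (induction n) (simp_all add: sweep_append)

lemma sweep_minus_id_bound:
  assumes h: "0 \<le> h" "h * rmax \<le> 1" and u: "\<And>\<eta>. \<bar>u \<eta>\<bar> \<le> C"
  shows "\<bar>sweep h xs u \<eta> - u \<eta>\<bar> \<le> h * (2 * rmax * real (length xs)) * C"
proof (induction xs)
  case (Cons i xs)
  have "\<bar>site_gen i (sweep h xs u) \<eta>\<bar> \<le> 2 * rmax * C"
    by (intro site_gen_bound_sup sweep_bound h u)
  then have "\<bar>h * site_gen i (sweep h xs u) \<eta>\<bar> \<le> h * (2 * rmax * C)"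
    using h by (simp add: abs_mult mult_left_mono)
  with Cons have "\<bar>sweep h (i # xs) u \<eta> - u \<eta>\<bar> \<le>
      h * (2 * rmax * real (length xs)) * C + h * (2 * rmax * C)"
    by (simp add: site_step_eq)
  then show ?case by (simp add: algebra_simps)
qed simp

lemma site_gen_diff: "site_gen i u \<eta> - site_gen i w \<eta> = site_gen i (\<lambda>\<eta>. u \<eta> - w \<eta>) \<eta>"
  by (simp add: site_gen_def sum_subtractf[symmetric] algebra_simps)

lemma sweep_first_order:
  assumes h: "0 \<le> h" "h * rmax \<le> 1" and u: "\<And>\<eta>. \<bar>u \<eta>\<bar> \<le> C"
  shows "\<bar>sweep h xs u \<eta> - u \<eta> - h * (\<Sum>i\<leftarrow>xs. site_gen i u \<eta>)\<bar>
    \<le> h\<^sup>2 * (2 * rmax * real (length xs))\<^sup>2 * C"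
proof (induction xs)
  case (Cons i xs)
  have C: "0 \<le> C" using u[of undefined] by linarith
  let ?K = "2 * rmax"
  have "\<bar>site_gen i (\<lambda>\<eta>. sweep h xs u \<eta> - u \<eta>) \<eta>\<bar> \<le> ?K * (h * (?K * real (length xs)) * C)"
    by (intro site_gen_bound_sup sweep_minus_id_bound h u)
  then have 1: "\<bar>h * (site_gen i (sweep h xs u) \<eta> - site_gen i u \<eta>)\<bar> \<le>
      h * (?K * (h * (?K * real (length xs)) * C))"
    using h by (simp add: abs_mult mult_left_mono site_gen_diff)
  have "sweep h (i # xs) u \<eta> - u \<eta> - h * (\<Sum>i\<leftarrow>i # xs. site_gen i u \<eta>) =
      (sweep h xs u \<eta> - u \<eta> - h * (\<Sum>i\<leftarrow>xs. site_gen i u \<eta>)) +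
      h * (site_gen i (sweep h xs u) \<eta> - site_gen i u \<eta>)"
    by (simp add: site_step_eq algebra_simps)
  then have "\<bar>sweep h (i # xs) u \<eta> - u \<eta> - h * (\<Sum>i\<leftarrow>i # xs. site_gen i u \<eta>)\<bar> \<le>
      h\<^sup>2 * (?K * real (length xs))\<^sup>2 * C + h * (?K * (h * (?K * real (length xs)) * C))"
    using 1 Cons by linarith
  also have "\<dots> = h\<^sup>2 * ?K\<^sup>2 * C * ((real (length xs))\<^sup>2 + real (length xs))"
    by (simp add: power2_eq_square algebra_simps)
  also have "\<dots> \<le> h\<^sup>2 * ?K\<^sup>2 * C * (real (length (i # xs)))\<^sup>2"
    using C by (intro mult_left_mono mult_nonneg_nonneg) (auto simp: power2_eq_square algebra_simps)
  also have "\<dots> = h\<^sup>2 * (?K * real (length (i # xs)))\<^sup>2 * C"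
    by (simp only: power_mult_distrib mult_ac)
  finally show ?case .
qed simp

definition osc_le :: "'v \<Rightarrow> real \<Rightarrow> (('v \<Rightarrow> 's) \<Rightarrow> real) \<Rightarrow> bool" where
  "osc_le i d u \<longleftrightarrow> (\<forall>\<eta> x. \<bar>u (\<eta>(i := x)) - u \<eta>\<bar> \<le> d)"

lemma osc_le_mono: "osc_le i d u \<Longrightarrow> d \<le> e \<Longrightarrow> osc_le i e u"
  unfolding osc_le_def by (meson order_trans)

lemma osc_le_site_step:
  assumes h: "0 \<le> h" "h * rmax \<le> 1" and i: "osc_le i d u" and j: "osc_le j e u"
  shows "osc_le i (d + (if i \<in> nbh j then 2 * h * rmax * e else 0)) (site_step h j u)"
proof (cases "i \<in> nbh j")
  case True
  have gen: "\<bar>h * site_gen j u \<eta>\<bar> \<le> h * (rmax * e)" for \<eta>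
    using site_gen_bound[of u \<eta> j e] j h by (simp add: osc_le_def abs_mult mult_left_mono)
  have "\<bar>site_step h j u (\<eta>(i := x)) - site_step h j u \<eta>\<bar> \<le> d + 2 * h * rmax * e" for \<eta> x
  proof -
    have "\<bar>u (\<eta>(i := x)) - u \<eta>\<bar> \<le> d" using i by (simp add: osc_le_def)
    then show ?thesis using gen[of \<eta>] gen[of "\<eta>(i := x)"] unfolding site_step_eq by linarith
  qed
  then show ?thesis using True by (simp add: osc_le_def)
next
  case False
  have ij: "i \<noteq> j" using False nbh_refl by auto
  have "\<bar>site_step h j u (\<eta>(i := x)) - site_step h j u \<eta>\<bar> \<le> d" for \<eta> x
  proof -
    have eq: "site_step h j u (\<eta>(i := x)) - site_step h j u \<eta> =
        (1 - h * exit_rate j \<eta>) * (u (\<eta>(i := x)) - u \<eta>) +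
        h * (\<Sum>b\<in>UNIV. c j \<eta> b * (u (\<eta>(j := b, i := x)) - u (\<eta>(j := b))))"
      using False ij
      by (simp add: site_step_def exit_rate_def c_upd fun_upd_twist[OF ij] algebra_simps sum_subtractf)
    have "\<bar>site_step h j u (\<eta>(i := x)) - site_step h j u \<eta>\<bar> \<le> \<bar>(1 - h * exit_rate j \<eta>) * (u (\<eta>(i := x)) - u \<eta>)\<bar> +
        \<bar>h * (\<Sum>b\<in>UNIV. c j \<eta> b * (u (\<eta>(j := b, i := x)) - u (\<eta>(j := b))))\<bar>"
      unfolding eq by (rule abs_triangle_ineq)
    also have "\<dots> \<le> (1 - h * exit_rate j \<eta>) * d + h * (\<Sum>b\<in>UNIV. c j \<eta> b * d)"
    proof (rule add_mono)
      show "\<bar>(1 - h * exit_rate j \<eta>) * (u (\<eta>(i := x)) - u \<eta>)\<bar> \<le> (1 - h * exit_rate j \<eta>) * d"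
        using holding_ge[of h j \<eta>] h i by (auto simp: abs_mult osc_le_def intro!: mult_mono)
      have "\<bar>\<Sum>b\<in>UNIV. c j \<eta> b * (u (\<eta>(j := b, i := x)) - u (\<eta>(j := b)))\<bar> \<le>
          (\<Sum>b\<in>UNIV. \<bar>c j \<eta> b * (u (\<eta>(j := b, i := x)) - u (\<eta>(j := b)))\<bar>)"
        by (rule sum_abs)
      also have "\<dots> \<le> (\<Sum>b\<in>UNIV. c j \<eta> b * d)"
        using i c_nonneg by (intro sum_mono) (auto simp: abs_mult osc_le_def intro!: mult_left_mono)
      finally show "\<bar>h * (\<Sum>b\<in>UNIV. c j \<eta> b * (u (\<eta>(j := b, i := x)) - u (\<eta>(j := b))))\<bar> \<le>
          h * (\<Sum>b\<in>UNIV. c j \<eta> b * d)"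
        using h by (simp add: abs_mult mult_left_mono)
    qed
    also have "\<dots> = d" by (simp only: exit_rate_def sum_distrib_right[symmetric]) (simp add: algebra_simps)
    finally show ?thesis .
  qed
  then show ?thesis using False by (simp add: osc_le_def)
qed

text \<open>
  A step at \<open>j\<close> changes the oscillation only at neighbours of \<open>j\<close>, so the oscillation at \<open>i\<close> picks up one
  factor \<open>1 + \<epsilon>\<close> for each visited neighbour of \<open>i\<close>: the bound does not depend on the length of the sweep.
\<close>

lemma osc_le_sweep:
  assumes h: "0 \<le> h" "h * rmax \<le> 1" and D: "0 \<le> D"
    and w: "\<And>i. 0 \<le> w i" "\<And>i j. j \<in> nbh i \<Longrightarrow> w j \<le> \<kappa> * w i" and \<kappa>: "0 \<le> \<kappa>"
    and \<epsilon>: "\<epsilon> = 4 * h * rmax * \<kappa>" "(1 + \<epsilon>) ^ L \<le> 2"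
    and u: "\<And>i. osc_le i (D * w i) u" and xs: "distinct xs"
  shows "osc_le i (D * w i * (1 + \<epsilon>) ^ L) (sweep h xs u)"
proof -
  have \<epsilon>0: "0 \<le> \<epsilon>" using h rmax_pos \<kappa> by (simp add: \<epsilon>)
  have card_le: "card (set xs \<inter> nbh i) \<le> L" for xs i
    using card_nbh[of i] card_mono[OF finite_nbh, of "set xs \<inter> nbh i" i] by auto
  have *: "osc_le i (D * w i * (1 + \<epsilon>) ^ card (set xs \<inter> nbh i)) (sweep h xs u)" for i
    using xs
  proof (induction xs arbitrary: i)
    case Nil
    then show ?case using u by simp
  next
    case (Cons j xs)
    let ?n = "\<lambda>i. card (set xs \<inter> nbh i)"
    have step: "osc_le i (D * w i * (1 + \<epsilon>) ^ ?n i +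
        (if i \<in> nbh j then 2 * h * rmax * (D * w j * (1 + \<epsilon>) ^ ?n j) else 0)) (sweep h (j # xs) u)"
      using osc_le_site_step[OF h Cons.IH Cons.IH, of i j] Cons.prems by simp
    show ?case
    proof (cases "i \<in> nbh j")
      case False
      then have "j \<notin> nbh i" using nbh_sym by blast
      then show ?thesis using step False by simp
    next
      case True
      then have j: "j \<in> nbh i" using nbh_sym by blast
      have "(1 + \<epsilon>) ^ ?n j \<le> 2"
        using power_increasing[OF card_le[of xs j], of "1 + \<epsilon>"] \<epsilon> \<epsilon>0 by simp
      then have "2 * h * rmax * (D * w j * (1 + \<epsilon>) ^ ?n j) \<le> 2 * h * rmax * (D * (\<kappa> * w i) * 2)"
        using h rmax_pos D w(1) w(2)[OF j] \<kappa> \<epsilon>0 by (intro mult_left_mono mult_mono) auto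
      also have "\<dots> = D * w i * \<epsilon> * 1" by (simp add: \<epsilon>)
      also have "\<dots> \<le> D * w i * \<epsilon> * (1 + \<epsilon>) ^ ?n i"
        using D w \<epsilon>0 by (intro mult_left_mono one_le_power mult_nonneg_nonneg) auto
      finally have "D * w i * (1 + \<epsilon>) ^ ?n i + 2 * h * rmax * (D * w j * (1 + \<epsilon>) ^ ?n j)
          \<le> D * w i * (1 + \<epsilon>) ^ Suc (?n i)"
        by (simp add: algebra_simps)
      moreover have "card (set (j # xs) \<inter> nbh i) = Suc (?n i)"
        using Cons.prems j by simp
      ultimately show ?thesis using step True by (simp add: osc_le_mono)
    qed
  qed
  show ?thesis
    using D w(1) \<epsilon>0 by (intro osc_le_mono[OF *] mult_left_mono power_increasing card_le) auto
qed

lemma osc_le_sweep_pow: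
  assumes h: "0 \<le> h" "h * rmax \<le> 1" and D: "0 \<le> D"
    and w: "\<And>i. 0 \<le> w i" "\<And>i j. j \<in> nbh i \<Longrightarrow> w j \<le> \<kappa> * w i" and \<kappa>: "0 \<le> \<kappa>"
    and \<epsilon>: "\<epsilon> = 4 * h * rmax * \<kappa>" "(1 + \<epsilon>) ^ L \<le> 2"
    and u: "\<And>i. osc_le i (D * w i) u" and xs: "distinct xs"
  shows "osc_le i (D * w i * (1 + \<epsilon>) ^ (L * k)) ((sweep h xs ^^ k) u)"
proof (induction k arbitrary: i)
  case 0
  then show ?case using u by simp
next
  case (Suc k)
  have \<epsilon>0: "0 \<le> \<epsilon>" using h rmax_pos \<kappa> by (simp add: \<epsilon>)
  have "osc_le i ((D * (1 + \<epsilon>) ^ (L * k)) * w i * (1 + \<epsilon>) ^ L) (sweep h xs ((sweep h xs ^^ k) u))"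
    by (rule osc_le_sweep[OF h _ w \<kappa> \<epsilon> _ xs]) (use Suc D \<epsilon>0 in \<open>auto simp: mult_ac\<close>)
  then show ?case by (simp add: power_add algebra_simps)
qed

end

section \<open>Approximation of the semigroup\<close>

lemma feller_contraction:
  assumes P: "feller_semigroup P" and t: "0 \<le> t" shows "norm (P t f) \<le> norm f"
proof (rule norm_bound)
  fix \<eta>
  have lin: "linear (P t)" and one: "P t (const_bcontfun 1) = const_bcontfun 1"
    and pos: "\<And>f. (\<And>\<eta>. 0 \<le> apply_bcontfun f \<eta>) \<Longrightarrow> 0 \<le> apply_bcontfun (P t f) \<eta>"
    using P t unfolding feller_semigroup_def by auto
  have "0 \<le> apply_bcontfun (norm f *\<^sub>R const_bcontfun 1 - s *\<^sub>R f) \<eta>" if "\<bar>s\<bar> = 1" for s \<eta>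
    using norm_bounded[of f \<eta>] that by (auto simp: const_bcontfun.rep_eq abs_if split: if_splits)
  then have "0 \<le> apply_bcontfun (P t (norm f *\<^sub>R const_bcontfun 1 - s *\<^sub>R f)) \<eta>" if "\<bar>s\<bar> = 1" for s
    using that by (intro pos)
  from this[of 1] this[of "-1"] show "norm (apply_bcontfun (P t f) \<eta>) \<le> norm f"
    by (simp add: linear_diff[OF lin] linear_add[OF lin] linear_cmul[OF lin] linear_neg[OF lin] one const_bcontfun.rep_eq abs_le_iff)
qed

lemma feller_telescope:
  assumes P: "feller_semigroup P" and s: "0 \<le> s"
  shows "P (real n * s) f - f = (\<Sum>k<n. P (real k * s) (P s f - f))"
proof (induction n)
  case 0
  then show ?case using P by (simp add: feller_semigroup_def)
next
  case (Suc n)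
  have "P (real n * s + s) = P (real n * s) \<circ> P s" and lin: "linear (P (real n * s))"
    using P s unfolding feller_semigroup_def by auto
  then have "P (real (Suc n) * s) f - f = (P (real n * s) f - f) + P (real n * s) (P s f - f)"
    by (simp add: distrib_right linear_diff[OF lin] add.commute[of s])
  with Suc show ?case by simp
qed

lemma feller_generator_seq:
  assumes g: "(f, g) \<in> semigroup_generator_graph P" and t: "0 < t"
  shows "(\<lambda>n. real n *\<^sub>R (P (t / real n) f - f)) \<longlonglongrightarrow> t *\<^sub>R g"
proof -
  have "filterlim (\<lambda>n. t / real n) (at_right 0) sequentially"
    unfolding filterlim_at
    using t by (auto intro!: tendsto_divide_0[OF tendsto_const] filterlim_at_top_imp_at_infinity
        filterlim_real_sequentially eventually_sequentiallyI[of 1])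
  then have "(\<lambda>n. (P (t / real n) f - f) /\<^sub>R (t / real n)) \<longlonglongrightarrow> g"
    using g unfolding semigroup_generator_graph_def
    by (auto intro: filterlim_compose[where f = "\<lambda>n. t / real n" and g = "\<lambda>t. (P t f - f) /\<^sub>R t"]
        simp del: inverse_divide)
  from tendsto_scaleR[OF tendsto_const[of t] this]
  show ?thesis
    using t by (simp add: field_simps)
qed

lemma feller_increment_le:
  assumes P: "feller_semigroup P" and g: "(f, g) \<in> semigroup_generator_graph P" and t: "0 \<le> t"
  shows "norm (P t f - f) \<le> t * norm g"
proof (cases "t = 0")
  case True
  then show ?thesis using P by (simp add: feller_semigroup_def)
next
  case False
  then have t: "0 < t" using t by simp
  have "norm (P t f - f) \<le> norm (real n *\<^sub>R (P (t / real n) f - f))" if "1 \<le> n" for n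
  proof -
    have "norm (P t f - f) = norm (\<Sum>k<n. P (real k * (t / real n)) (P (t / real n) f - f))"
      using feller_telescope[OF P, of "t / real n" n f] t that by simp
    also have "\<dots> \<le> (\<Sum>k<n. norm (P (t / real n) f - f))"
      using t by (intro sum_norm_le feller_contraction[OF P]) auto
    finally show ?thesis by simp
  qed
  then have "norm (P t f - f) \<le> norm (t *\<^sub>R g)"
    by (intro LIMSEQ_le_const[OF tendsto_norm[OF feller_generator_seq[OF g t]]]) blast
  then show ?thesis using t by simp
qed

text \<open>
  Splitting \<open>[0, t]\<close> into \<open>n\<close> steps and letting \<open>n \<rightarrow> \<infinity>\<close> avoids integrating \<open>s \<mapsto> P\<^sub>s g\<close>; this costs only
  a factor \<open>2\<close> in the constant.
\<close>

lemma feller_first_order: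
  assumes P: "feller_semigroup P" and g: "(f, g) \<in> semigroup_generator_graph P"
    and g': "(g, g') \<in> semigroup_generator_graph P" and t: "0 \<le> t"
  shows "norm (P t f - f - t *\<^sub>R g) \<le> t\<^sup>2 * norm g'"
proof (cases "t = 0")
  case True
  then show ?thesis using P by (simp add: feller_semigroup_def)
next
  case False
  then have t: "0 < t" using t by simp
  have "norm (P t f - f - t *\<^sub>R g) \<le> norm (real n *\<^sub>R (P (t / real n) f - f) - t *\<^sub>R g) + t\<^sup>2 * norm g'"
    if n: "1 \<le> n" for n
  proof -
    define s where "s = t / real n"
    have s: "0 \<le> s" "t = real n * s" "0 < real n" using t n by (auto simp: s_def)
    have "P t f - f - t *\<^sub>R g = (\<Sum>k<n. P (real k * s) (P s f - f)) - (\<Sum>k<n. s *\<^sub>R g)"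
      using feller_telescope[OF P s(1), of n f] s by (simp add: sum_constant_scaleR)
    also have "\<dots> = (\<Sum>k<n. P (real k * s) (P s f - f - s *\<^sub>R g) + s *\<^sub>R (P (real k * s) g - g))"
    proof (subst sum_subtractf[symmetric], rule sum.cong)
      fix k
      have lin: "linear (P (real k * s))" using P s unfolding feller_semigroup_def by auto
      show "P (real k * s) (P s f - f) - s *\<^sub>R g =
        P (real k * s) (P s f - f - s *\<^sub>R g) + s *\<^sub>R (P (real k * s) g - g)"
        by (simp add: linear_diff[OF lin, of "P s f - f"] linear_cmul[OF lin] scaleR_diff_right)
    qed simp
    also have "norm \<dots> \<le> (\<Sum>k<n. norm (P s f - f - s *\<^sub>R g) + s * (t * norm g'))"
    proof (intro sum_norm_le norm_triangle_le add_mono)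
      fix k assume k: "k \<in> {..<n}"
      show "norm (P (real k * s) (P s f - f - s *\<^sub>R g)) \<le> norm (P s f - f - s *\<^sub>R g)"
        using s by (intro feller_contraction[OF P]) auto
      have "norm (P (real k * s) g - g) \<le> real k * s * norm g'"
        using s by (intro feller_increment_le[OF P g']) auto
      also have "\<dots> \<le> t * norm g'"
        using k s by (auto intro!: mult_right_mono)
      finally show "norm (s *\<^sub>R (P (real k * s) g - g)) \<le> s * (t * norm g')"
        using s by (simp add: mult_left_mono)
    qed
    also have "\<dots> = norm (real n *\<^sub>R (P s f - f - s *\<^sub>R g)) + t\<^sup>2 * norm g'"
      by (simp add: distrib_left) (simp add: s(2) power2_eq_square mult_ac)
    also have "real n *\<^sub>R (P s f - f - s *\<^sub>R g) = real n *\<^sub>R (P s f - f) - t *\<^sub>R g"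
      by (simp add: s(2) algebra_simps)
    finally show ?thesis by (simp add: s_def)
  qed
  moreover have "(\<lambda>n. norm (real n *\<^sub>R (P (t / real n) f - f) - t *\<^sub>R g) + t\<^sup>2 * norm g') \<longlonglongrightarrow>
      norm (t *\<^sub>R g - t *\<^sub>R g) + t\<^sup>2 * norm g'"
    by (intro tendsto_intros feller_generator_seq[OF g t])
  ultimately show ?thesis
    by (auto intro: LIMSEQ_le_const)
qed

definition local_fun :: "(('v \<Rightarrow> 's) \<Rightarrow> 'b) \<Rightarrow> bool" where
  "local_fun u \<longleftrightarrow> (\<exists>A. finite A \<and> depends_on A u)"

lemma open_cylinder:
  fixes \<eta> :: "'v \<Rightarrow> 's::discrete_topology"
  assumes "finite A"
  shows "open {\<sigma>. \<forall>i\<in>A. \<sigma> i = \<eta> i}"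
proof -
  have "{\<sigma>. \<forall>i\<in>A. \<sigma> i = \<eta> i} = (\<Inter>i\<in>A. (\<lambda>\<sigma>. \<sigma> i) -` {\<eta> i})" by auto
  also have "open \<dots>"
    using assms
    by (intro open_INT ballI open_vimage continuous_on_product_coordinates) (simp_all add: discrete_topology_class.open_discrete)
  finally show ?thesis .
qed

lemma open_vimage_local:
  fixes u :: "('v \<Rightarrow> 's::discrete_topology) \<Rightarrow> 'b"
  assumes "local_fun u"
  shows "open (u -` S)"
proof (subst open_subopen, intro ballI)
  fix \<eta> assume \<eta>: "\<eta> \<in> u -` S"
  obtain A where A: "finite A" "depends_on A u" using assms by (auto simp: local_fun_def)
  have "{\<sigma>. \<forall>i\<in>A. \<sigma> i = \<eta> i} \<subseteq> u -` S"
    using A(2) \<eta> unfolding depends_on_def by fastforce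
  then show "\<exists>T. open T \<and> \<eta> \<in> T \<and> T \<subseteq> u -` S"
    using open_cylinder[OF A(1), of \<eta>] by blast
qed

lemma finite_range_local:
  fixes u :: "('v \<Rightarrow> 's::finite) \<Rightarrow> 'b"
  assumes "local_fun u" shows "finite (range u)"
proof -
  obtain A where A: "finite A" "depends_on A u" using assms by (auto simp: local_fun_def)
  have "u \<eta> = u (restrict \<eta> A)" for \<eta> using A(2) by (auto simp: depends_on_def)
  then have "range u \<subseteq> u ` (\<Pi>\<^sub>E i\<in>A. UNIV)"
    by (metis image_subsetI imageI restrict_PiE_iff UNIV_I)
  moreover have "finite (\<Pi>\<^sub>E i\<in>A. UNIV :: 's set)" using A(1) by (intro finite_PiE) auto
  ultimately show ?thesis by (meson finite_imageI finite_subset)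
qed

lemma local_fun_bcontfun:
  fixes u :: "('v \<Rightarrow> 's::{finite, discrete_topology}) \<Rightarrow> real"
  assumes "local_fun u" shows "u \<in> bcontfun"
  using open_vimage_local[OF assms] finite_range_local[OF assms]
  by (auto simp: bcontfun_def finite_imp_bounded continuous_on_open_vimage)

lemma apply_Bcontfun_local:
  fixes u :: "('v \<Rightarrow> 's::{finite, discrete_topology}) \<Rightarrow> real"
  shows "local_fun u \<Longrightarrow> apply_bcontfun (Bcontfun u) = u"
  by (simp add: Bcontfun_inverse local_fun_bcontfun)

definition lattice_box :: "int ^ 'd \<Rightarrow> nat \<Rightarrow> (int ^ 'd::finite) set" where
  "lattice_box i n = {j. \<forall>k. \<bar>j $ k - i $ k\<bar> \<le> int n}"

lemma lattice_box_card: "finite (lattice_box i n) \<and> card (lattice_box (i :: int ^ 'd::finite) n) \<le> (2 * n + 1) ^ CARD('d)"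
proof -
  let ?P = "\<Pi>\<^sub>E k\<in>(UNIV::'d set). {i $ k - int n..i $ k + int n}"
  have sub: "lattice_box i n \<subseteq> vec_lambda ` ?P"
  proof
    fix j assume "j \<in> lattice_box i n"
    then have "vec_nth j \<in> ?P" by (auto simp: lattice_box_def abs_le_iff algebra_simps)
    then show "j \<in> vec_lambda ` ?P" 
      by (intro image_eqI[of _ _ "vec_nth j"]) (simp_all only: vec_nth_inverse)
  qed
  have fin: "finite ?P" by (intro finite_PiE) auto
  have "card (lattice_box i n) \<le> card (vec_lambda ` ?P)" using fin by (intro card_mono sub) auto
  also have "\<dots> \<le> card ?P" by (intro card_image_le fin)
  also have "\<dots> = (2 * n + 1) ^ CARD('d)" by (simp add: card_PiE nat_add_distrib nat_mult_distrib)
  finally show ?thesis using sub fin by (auto intro: finite_subset)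
qed

lemmas finite_lattice_box = lattice_box_card[THEN conjunct1]

lemma finite_subset_lattice_box:
  fixes A :: "(int ^ 'd::finite) set"
  assumes "finite A" shows "\<exists>n. A \<subseteq> lattice_box 0 n"
proof -
  define n where "n = Max (insert 0 ((\<lambda>(i, k). nat \<bar>i $ k\<bar>) ` (A \<times> UNIV)))"
  have "nat \<bar>i $ k\<bar> \<le> n" if "i \<in> A" for i k
    unfolding n_def using assms that by (intro Max_ge) (auto intro!: image_eqI[of _ _ "(i, k)"])
  then have "A \<subseteq> lattice_box 0 n" by (auto simp: lattice_box_def nat_le_iff)
  then show ?thesis by blast
qed

locale lattice_ips = comparable_rates c "\<lambda>i. lattice_box i r" reach m M L
  for c :: "('d::finite, 's::{finite, discrete_topology}) rates" and r reach m M L +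
  fixes P :: "real \<Rightarrow> ('d, 's) observable \<Rightarrow> ('d, 's) observable"
  assumes feller: "feller_semigroup P"
    and generator: "ips_graph c \<subseteq> semigroup_generator_graph P"
begin

lemma ips_generator_eq:
  assumes "depends_on A u" "finite A"
  shows "ips_generator c u \<eta> = (\<Sum>i\<in>A. site_gen i u \<eta>)"
proof -
  have "ips_generator c u \<eta> = (\<Sum>\<^sub>\<infinity>i\<in>A. site_gen i u \<eta>)"
    unfolding ips_generator_def site_gen_def[symmetric]
    using site_gen_outside[OF assms(1)] by (intro infsum_cong_neutral) auto
  then show ?thesis using assms by simp
qed

lemma local_generator:
  assumes "depends_on A u" "finite A"
  shows "local_fun (\<lambda>\<eta>. \<Sum>i\<in>A. site_gen i u \<eta>)"
    and "depends_on (\<Union>i\<in>A. A \<union> lattice_box i r) (\<lambda>\<eta>. \<Sum>i\<in>A. site_gen i u \<eta>)"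
    and "(Bcontfun u, Bcontfun (\<lambda>\<eta>. \<Sum>i\<in>A. site_gen i u \<eta>)) \<in> semigroup_generator_graph P"
proof -
  let ?g = "\<lambda>\<eta>. \<Sum>i\<in>A. site_gen i u \<eta>"
  show dep: "depends_on (\<Union>i\<in>A. A \<union> lattice_box i r) ?g"
    unfolding depends_on_def
  proof (intro allI impI sum.cong refl)
    fix \<eta> \<sigma> :: "('d, 's) config" and i
    assume *: "\<forall>j\<in>\<Union>i\<in>A. A \<union> lattice_box i r. \<eta> j = \<sigma> j" "i \<in> A"
    then have "\<forall>j\<in>A \<union> lattice_box i r. \<eta> j = \<sigma> j" by blast
    then show "site_gen i u \<eta> = site_gen i u \<sigma>"
      using depends_on_site_gen[OF assms(1), of i] unfolding depends_on_def by blast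
  qed
  then show loc: "local_fun ?g"
    using assms(2) finite_lattice_box unfolding local_fun_def
    by (intro exI[of _ "\<Union>i\<in>A. A \<union> lattice_box i r"]) auto
  have "local_fun u" using assms by (auto simp: local_fun_def)
  moreover have "ips_generator c u = ?g" using ips_generator_eq[OF assms] by (intro ext)
  ultimately have "(Bcontfun u, Bcontfun ?g) \<in> ips_graph c"
    using loc assms by (auto simp: ips_graph_def local_observable_def apply_Bcontfun_local depends_on_def)
  then show "(Bcontfun u, Bcontfun ?g) \<in> semigroup_generator_graph P" using generator by blast
qed

lemma sum_site_gen_bound:
  assumes "\<And>i \<eta>. i \<in> A \<Longrightarrow> \<bar>site_gen i u \<eta>\<bar> \<le> e"
  shows "\<bar>\<Sum>i\<in>A. site_gen i u \<eta>\<bar> \<le> real (card A) * e"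
  using order_trans[OF sum_abs sum_bounded_above, of A "\<lambda>i. site_gen i u \<eta>" e] assms by auto

lemma one_step_error:
  assumes h: "0 \<le> h" "h * rmax \<le> 1" and A: "depends_on A u" "finite A"
    and C: "\<And>\<eta>. \<bar>u \<eta>\<bar> \<le> C" and xs: "distinct xs" "\<And>i. i \<in> set xs \<Longrightarrow> lattice_box i r \<subseteq> A"
    and e: "\<And>i \<eta>. i \<in> A - set xs \<Longrightarrow> \<bar>site_gen i u \<eta>\<bar> \<le> e" and e0: "0 \<le> e"
    and K: "K = real (card (\<Union>i\<in>A. A \<union> lattice_box i r)) * (2 * rmax * (real (card A) * (2 * rmax))) +
      (2 * rmax * real (length xs))\<^sup>2"
  shows "norm (P h (Bcontfun u) - Bcontfun (sweep h xs u)) \<le> h\<^sup>2 * K * C + h * (real (card A) * e)"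
proof (rule norm_bound)
  fix \<eta>
  define A' where "A' = (\<Union>i\<in>A. A \<union> lattice_box i r)"
  define g where "g = (\<lambda>\<eta>. \<Sum>i\<in>A. site_gen i u \<eta>)"
  define g' where "g' = (\<lambda>\<eta>. \<Sum>i\<in>A'. site_gen i g \<eta>)"
  have A': "finite A'" using A finite_lattice_box by (auto simp: A'_def)
  note g = local_generator[OF A, folded A'_def g_def]
  note g' = local_generator[OF g(2) A', folded g'_def]
  have gb: "\<bar>g \<eta>\<bar> \<le> real (card A) * (2 * rmax * C)" for \<eta>
    unfolding g_def by (intro sum_site_gen_bound site_gen_bound_sup C)
  have "norm (Bcontfun g') \<le> real (card A') * (2 * rmax * (real (card A) * (2 * rmax * C)))"
  proof (rule norm_bound)
    fix \<sigma>
    have "\<bar>\<Sum>i\<in>A'. site_gen i g \<sigma>\<bar> \<le> real (card A') * (2 * rmax * (real (card A) * (2 * rmax * C)))"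
      by (intro sum_site_gen_bound site_gen_bound_sup gb)
    then show "norm (apply_bcontfun (Bcontfun g') \<sigma>) \<le> real (card A') * (2 * rmax * (real (card A) * (2 * rmax * C)))"
      by (simp add: apply_Bcontfun_local[OF g'(1)]) (simp add: g'_def)
  qed
  then have "h\<^sup>2 * norm (Bcontfun g') \<le>
      h\<^sup>2 * (real (card A') * (2 * rmax * (real (card A) * (2 * rmax * C))))"
    by (intro mult_left_mono) auto
  with feller_first_order[OF feller g(3) g'(3) h(1)]
  have 1: "norm (P h (Bcontfun u) - Bcontfun u - h *\<^sub>R Bcontfun g) \<le>
      h\<^sup>2 * (real (card A') * (2 * rmax * (real (card A) * (2 * rmax * C))))" by linarith
  have lu: "local_fun u" using A by (auto simp: local_fun_def)
  have sub: "set xs \<subseteq> A" using xs(2) nbh_refl by blast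
  have ls: "local_fun (sweep h xs u)"
    using depends_on_sweep[OF A(1) xs(2)] A(2) by (auto simp: local_fun_def)
  have "\<bar>P h (Bcontfun u) \<eta> - u \<eta> - h * g \<eta>\<bar> \<le>
      h\<^sup>2 * (real (card A') * (2 * rmax * (real (card A) * (2 * rmax * C))))"
    using order_trans[OF norm_bounded 1, of \<eta>]
    by (simp add: apply_Bcontfun_local[OF lu] apply_Bcontfun_local[OF g(1)])
  moreover have "\<bar>sweep h xs u \<eta> - u \<eta> - h * (\<Sum>i\<leftarrow>xs. site_gen i u \<eta>)\<bar>
      \<le> h\<^sup>2 * (2 * rmax * real (length xs))\<^sup>2 * C"
    by (intro sweep_first_order h C)
  moreover have "g \<eta> = (\<Sum>i\<leftarrow>xs. site_gen i u \<eta>) + (\<Sum>i\<in>A - set xs. site_gen i u \<eta>)"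
    using sub A(2) xs(1)
    by (simp add: g_def sum_list_distinct_conv_sum_set sum.subset_diff[of "set xs" A])
  moreover have "\<bar>h * (\<Sum>i\<in>A - set xs. site_gen i u \<eta>)\<bar> \<le> h * (real (card A) * e)"
  proof -
    have "\<bar>\<Sum>i\<in>A - set xs. site_gen i u \<eta>\<bar> \<le> real (card (A - set xs)) * e"
      by (intro sum_site_gen_bound e)
    also have "\<dots> \<le> real (card A) * e"
      using A(2) e0 by (intro mult_right_mono) (auto intro: card_mono)
    finally show ?thesis using h by (simp add: abs_mult mult_left_mono)
  qed
  ultimately have "\<bar>P h (Bcontfun u) \<eta> - sweep h xs u \<eta>\<bar> \<le>
      h\<^sup>2 * (real (card A') * (2 * rmax * (real (card A) * (2 * rmax * C)))) +
      h\<^sup>2 * (2 * rmax * real (length xs))\<^sup>2 * C + h * (real (card A) * e)"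
    by (simp add: distrib_left)
  also have "\<dots> = h\<^sup>2 * K * C + h * (real (card A) * e)"
    by (simp add: K A'_def algebra_simps)
  finally show "norm (apply_bcontfun (P h (Bcontfun u) - Bcontfun (sweep h xs u)) \<eta>) \<le>
      h\<^sup>2 * K * C + h * (real (card A) * e)"
    by (simp add: apply_Bcontfun_local[OF ls])
qed

lemma multi_step_error:
  assumes h: "0 \<le> h" and u0: "local_fun u"
    and loc: "\<And>k. k < n \<Longrightarrow> local_fun ((sweep h xs ^^ k) u)"
    and err: "\<And>k. k < n \<Longrightarrow>
      norm (P h (Bcontfun ((sweep h xs ^^ k) u)) - Bcontfun ((sweep h xs ^^ Suc k) u)) \<le> e"
  shows "norm (P (real n * h) (Bcontfun u) - Bcontfun ((sweep h xs ^^ n) u)) \<le> real n * e"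
  using loc err
proof (induction n)
  case 0
  then show ?case using feller by (simp add: feller_semigroup_def)
next
  case (Suc n)
  define v where "v = Bcontfun ((sweep h xs ^^ n) u)"
  have "P (h + real n * h) = P h \<circ> P (real n * h)" and lin: "linear (P h)"
    using feller h unfolding feller_semigroup_def by auto
  then have "P (real (Suc n) * h) (Bcontfun u) - Bcontfun ((sweep h xs ^^ Suc n) u) =
      P h (P (real n * h) (Bcontfun u) - v) + (P h v - Bcontfun ((sweep h xs ^^ Suc n) u))"
    by (simp add: distrib_right linear_diff[OF lin])
  also have "norm \<dots> \<le> real n * e + e"
  proof (intro norm_triangle_le add_mono)
    have "norm (P h (P (real n * h) (Bcontfun u) - v)) \<le> norm (P (real n * h) (Bcontfun u) - v)"
      by (intro feller_contraction[OF feller] h)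
    also have "\<dots> \<le> real n * e" unfolding v_def using Suc by auto
    finally show "norm (P h (P (real n * h) (Bcontfun u) - v)) \<le> real n * e" .
    show "norm (P h v - Bcontfun ((sweep h xs ^^ Suc n) u)) \<le> e"
      unfolding v_def using Suc.prems by blast
  qed
  finally show ?case by (simp add: algebra_simps)
qed


text \<open>
  The truncation to the box of radius \<open>R\<close> costs only the generators at sites outside the box but within
  distance \<open>r\<close> of it, where the oscillation of the iterates is of order \<open>e\<^sup>-\<^sup>R\<close>; the time discretisation
  costs \<open>O(1/n)\<close> with a constant depending on \<open>R\<close>. Hence the order of the two limits.
\<close>

lemma sweep_approximation:
  assumes f: "local_fun f" and \<tau>: "0 < \<tau>" and \<epsilon>: "0 < \<epsilon>"
  shows "\<forall>\<^sub>F R in sequentially. \<forall>xs. distinct xs \<and> set xs = lattice_box 0 R \<longrightarrow>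
    (\<forall>\<^sub>F n in sequentially. norm (P \<tau> (Bcontfun f) - Bcontfun ((sweep (\<tau> / real n) xs ^^ n) f)) \<le> \<epsilon>)"
proof -
  obtain A0 where A0: "finite A0" "depends_on A0 f" using f by (auto simp: local_fun_def)
  obtain n0 where "A0 \<subseteq> lattice_box 0 n0" using finite_subset_lattice_box[OF A0(1)] by blast
  with A0(2) have f0: "depends_on (lattice_box 0 n0) f" by (rule depends_on_mono)
  define d where "d = CARD('d)"
  define C where "C = norm (Bcontfun f)"
  have C: "\<bar>f \<eta>\<bar> \<le> C" for \<eta>
    using norm_bounded[of "Bcontfun f" \<eta>] by (simp add: C_def apply_Bcontfun_local[OF f])
  have C0: "0 \<le> C" by (simp add: C_def)
  define l1 where "l1 = (\<lambda>i::int ^ 'd. \<Sum>k\<in>UNIV. real_of_int \<bar>i $ k\<bar>)"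
  define w where "w = (\<lambda>i. exp (- l1 i))"
  define \<kappa> where "\<kappa> = exp (real (d * r))"
  define D where "D = 2 * C * exp (real (d * n0))"
  have D0: "0 \<le> D" using C0 by (simp add: D_def)
  have w0: "0 \<le> w i" for i by (simp add: w_def)
  have w\<kappa>: "w j \<le> \<kappa> * w i" if "j \<in> lattice_box i r" for i j
  proof -
    have "l1 i \<le> (\<Sum>k\<in>(UNIV::'d set). real_of_int \<bar>j $ k\<bar> + real r)"
      unfolding l1_def
    proof (intro sum_mono)
      fix k :: 'd
      have "\<bar>j $ k - i $ k\<bar> \<le> int r" using that by (simp add: lattice_box_def)
      then have "\<bar>i $ k\<bar> \<le> \<bar>j $ k\<bar> + int r" by linarith
      then show "real_of_int \<bar>i $ k\<bar> \<le> real_of_int \<bar>j $ k\<bar> + real r" by linarith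
    qed
    also have "\<dots> = l1 j + real (d * r)" by (simp add: l1_def d_def sum.distrib)
    finally show ?thesis by (simp add: w_def \<kappa>_def exp_add[symmetric])
  qed
  have osc_f: "osc_le i (D * w i) f" for i
  proof (cases "i \<in> lattice_box 0 n0")
    case True
    have "l1 i \<le> (\<Sum>k\<in>(UNIV::'d set). real n0)"
      unfolding l1_def
    proof (intro sum_mono)
      fix k :: 'd
      have "\<bar>i $ k\<bar> \<le> int n0" using True by (simp add: lattice_box_def)
      then show "real_of_int \<bar>i $ k\<bar> \<le> real n0" by linarith
    qed
    then have "1 \<le> exp (real (d * n0)) * w i"
      by (simp add: w_def d_def exp_add[symmetric])
    then have "2 * C * 1 \<le> 2 * C * (exp (real (d * n0)) * w i)" using C0 by (intro mult_left_mono) auto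
    then have le: "2 * C \<le> D * w i" by (simp add: D_def mult.assoc)
    have "\<bar>f (\<eta>(i := x)) - f \<eta>\<bar> \<le> D * w i" for \<eta> x
      using C[of \<eta>] C[of "\<eta>(i := x)"] le by linarith
    then show ?thesis by (simp add: osc_le_def)
  next
    case False
    then show ?thesis using depends_on_upd[OF f0 False] D0 w0[of i] by (simp add: osc_le_def)
  qed
  define E where "E = exp (4 * \<tau> * rmax * \<kappa> * real L)"
  define e where "e = (\<lambda>R. rmax * (D * exp (- real R) * E))"
  have e0: "0 \<le> e R" for R using rmax_pos D0 by (simp add: e_def E_def)
  define F where "F = (\<lambda>R. (2 * (real R + real r) + 1) ^ d * e R)"
  have main: "norm (P \<tau> (Bcontfun f) - Bcontfun ((sweep (\<tau> / real n) xs ^^ n) f)) \<le> \<tau>\<^sup>2 * K * C / real n + \<tau> * F R"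
    if R: "n0 \<le> R" and xs: "distinct xs" "set xs = lattice_box 0 R" and n: "0 < n"
      "\<tau> / real n * rmax \<le> 1" "(1 + 4 * (\<tau> / real n) * rmax * \<kappa>) ^ L \<le> 2"
      and K: "K = real (card (\<Union>i\<in>(lattice_box 0 (R + r) :: (int ^ 'd) set). lattice_box 0 (R + r) \<union> lattice_box i r)) *
        (2 * rmax * (real (card (lattice_box 0 (R + r) :: (int ^ 'd) set)) * (2 * rmax))) + (2 * rmax * real (length xs))\<^sup>2"
    for R xs n K
  proof -
    define h where "h = \<tau> / real n"
    define A where "A = (lattice_box 0 (R + r) :: (int ^ 'd) set)"
    define v where "v = (\<lambda>k. (sweep h xs ^^ k) f)"
    have h: "0 \<le> h" "h * rmax \<le> 1" "real n * h = \<tau>" using \<tau> n by (auto simp: h_def)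
    have A: "finite A" by (simp add: A_def finite_lattice_box)
    have nA: "lattice_box i r \<subseteq> A" if "i \<in> set xs" for i
    proof
      fix j assume j: "j \<in> lattice_box i r"
      have "\<bar>j $ k\<bar> \<le> int (R + r)" for k
      proof -
        have "\<bar>j $ k - i $ k\<bar> \<le> int r" "\<bar>i $ k\<bar> \<le> int R"
          using j that xs(2) by (auto simp: lattice_box_def)
        then show ?thesis by linarith
      qed
      then show "j \<in> A" by (simp add: A_def lattice_box_def)
    qed
    have fA: "depends_on A f"
      using R by (intro depends_on_mono[OF f0]) (auto simp: A_def lattice_box_def intro: order_trans)
    have vdep: "depends_on A (v k)" for k
      using fA nA by (induction k) (auto simp: v_def intro: depends_on_sweep)
    have vC: "\<bar>v k \<eta>\<bar> \<le> C" for k \<eta>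
    proof -
      have "\<And>\<eta>. \<bar>v k \<eta>\<bar> \<le> C"
        using C h by (induction k) (auto simp: v_def intro: sweep_bound)
      then show ?thesis .
    qed
    have vosc: "\<bar>site_gen i (v k) \<eta>\<bar> \<le> e R" if i: "i \<in> A - set xs" and k: "k < n" for i k \<eta>
    proof -
      let ?\<epsilon> = "4 * h * rmax * \<kappa>"
      have \<epsilon>0: "0 \<le> ?\<epsilon>" using h rmax_pos by (simp add: \<kappa>_def)
      have "osc_le i (D * w i * (1 + ?\<epsilon>) ^ (L * k)) (v k)"
        unfolding v_def
        by (rule osc_le_sweep_pow[OF h(1,2) D0 w0 w\<kappa> _ refl _ osc_f xs(1)]) (use n in \<open>auto simp: h_def \<kappa>_def\<close>)
      then have "\<bar>site_gen i (v k) \<eta>\<bar> \<le> rmax * (D * w i * (1 + ?\<epsilon>) ^ (L * k))"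
        by (intro site_gen_bound) (simp add: osc_le_def)
      also have "\<dots> \<le> e R"
        unfolding e_def
      proof (intro mult_left_mono mult_mono)
        obtain k' where k': "int R < \<bar>i $ k'\<bar>" using i xs(2) by (auto simp: lattice_box_def not_le)
        have "real_of_int \<bar>i $ k'\<bar> \<le> l1 i" unfolding l1_def by (rule member_le_sum) auto
        then show "w i \<le> exp (- real R)" using k' by (simp add: w_def)
        have "(1 + ?\<epsilon>) ^ (L * k) \<le> exp ?\<epsilon> ^ (L * k)"
          using \<epsilon>0 by (intro power_mono) auto
        also have "\<dots> = exp (?\<epsilon> * real (L * k))" by (simp add: exp_of_nat_mult[symmetric] mult.commute)
        also have "\<dots> \<le> E"
        proof -
          have "?\<epsilon> * real (L * k) \<le> ?\<epsilon> * real (L * n)"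
            using k \<epsilon>0 by (intro mult_left_mono) (auto intro!: mult_left_mono)
          also have "\<dots> = 4 * (real n * h) * rmax * \<kappa> * real L" by simp
          finally show ?thesis by (simp add: E_def h(3))
        qed
        finally show "(1 + ?\<epsilon>) ^ (L * k) \<le> E" .
      qed (use D0 w0 rmax_pos \<epsilon>0 in auto)
      finally show ?thesis .
    qed
    have "norm (P (real n * h) (Bcontfun f) - Bcontfun ((sweep h xs ^^ n) f)) \<le>
        real n * (h\<^sup>2 * K * C + h * (real (card A) * e R))"
    proof (rule multi_step_error[OF h(1) f])
      fix k assume k: "k < n"
      show "local_fun ((sweep h xs ^^ k) f)"
        using vdep[of k] A by (auto simp: local_fun_def v_def)
      have "norm (P h (Bcontfun (v k)) - Bcontfun (sweep h xs (v k))) \<le> h\<^sup>2 * K * C + h * (real (card A) * e R)"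
        by (rule one_step_error[OF h(1,2) vdep A vC xs(1) nA _ e0 K[folded A_def]]) (use vosc[OF _ k] in auto)
      then show "norm (P h (Bcontfun ((sweep h xs ^^ k) f)) - Bcontfun ((sweep h xs ^^ Suc k) f)) \<le>
          h\<^sup>2 * K * C + h * (real (card A) * e R)"
        by (simp add: v_def)
    qed
    also have "\<dots> \<le> real n * (h\<^sup>2 * K * C + h * F R)"
    proof -
      have "real (card A) \<le> real ((2 * (R + r) + 1) ^ CARD('d))"
        unfolding A_def using lattice_box_card[of "0 :: int ^ 'd" "R + r"] by linarith
      then have "real (card A) * e R \<le> F R"
        unfolding F_def using e0 by (intro mult_right_mono) (simp_all add: d_def algebra_simps)
      then show ?thesis using h n by (intro mult_left_mono add_left_mono) auto
    qed
    also have "\<dots> = \<tau>\<^sup>2 * K * C / real n + \<tau> * F R"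
      using n by (simp add: h_def power2_eq_square field_simps)
    finally show ?thesis by (simp add: h(3)) (simp add: h_def)
  qed
  have "(\<lambda>R. \<tau> * F R) \<longlonglongrightarrow> \<tau> * (rmax * D * E * exp (real r + 1/2) * 0)"
  proof -
    define y where "y = (\<lambda>R::nat. real R + real r + 1/2)"
    have "filterlim y at_top sequentially"
      by (rule filterlim_at_top_mono[OF filterlim_real_sequentially]) (simp add: y_def)
    then have "(\<lambda>R. y R ^ d / exp (y R)) \<longlonglongrightarrow> 0"
      by (rule filterlim_compose[OF tendsto_power_div_exp_0])
    then have "(\<lambda>R. \<tau> * (rmax * D * E * exp (real r + 1/2) * (2 ^ d * (y R ^ d / exp (y R))))) \<longlonglongrightarrow>
        \<tau> * (rmax * D * E * exp (real r + 1/2) * (2 ^ d * 0))"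
      by (intro tendsto_intros)
    moreover have "F R = rmax * D * E * exp (real r + 1/2) * (2 ^ d * (y R ^ d / exp (y R)))" for R
    proof -
      have "(2 * (real R + real r) + 1) ^ d = 2 ^ d * y R ^ d"
        by (simp add: y_def power_mult_distrib[symmetric] algebra_simps)
      moreover have "exp (- real R) = exp (real r + 1/2) / exp (y R)"
        by (simp add: y_def exp_diff[symmetric])
      ultimately show ?thesis by (simp add: F_def e_def)
    qed
    ultimately show ?thesis by simp
  qed
  then have "\<forall>\<^sub>F R in sequentially. \<tau> * F R < \<epsilon> / 2"
    using \<epsilon> by (intro order_tendstoD(2)) auto
  then show ?thesis
    using eventually_ge_at_top[of n0]
  proof eventually_elim
    case (elim R)
    show ?case
    proof (intro allI impI)
      fix xs :: "(int ^ 'd) list" assume xs: "distinct xs \<and> set xs = lattice_box 0 R"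
      define K where "K = real (card (\<Union>i\<in>(lattice_box 0 (R + r) :: (int ^ 'd) set). lattice_box 0 (R + r) \<union> lattice_box i r)) *
        (2 * rmax * (real (card (lattice_box 0 (R + r) :: (int ^ 'd) set)) * (2 * rmax))) + (2 * rmax * real (length xs))\<^sup>2"
      have inv: "(\<lambda>n. a / real n) \<longlonglongrightarrow> 0" for a :: real
        by (rule lim_const_over_n)
      have "(\<lambda>n. \<tau> / real n * rmax) \<longlonglongrightarrow> 0 * rmax" by (intro tendsto_intros inv)
      then have 1: "\<forall>\<^sub>F n in sequentially. \<tau> / real n * rmax < 1"
        by (intro order_tendstoD(2)) auto
      have "(\<lambda>n. (1 + 4 * (\<tau> / real n) * rmax * \<kappa>) ^ L) \<longlonglongrightarrow> (1 + 4 * 0 * rmax * \<kappa>) ^ L"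
        by (intro tendsto_intros inv)
      then have 2: "\<forall>\<^sub>F n in sequentially. (1 + 4 * (\<tau> / real n) * rmax * \<kappa>) ^ L < 2"
        by (intro order_tendstoD(2)) auto
      have 3: "\<forall>\<^sub>F n in sequentially. \<tau>\<^sup>2 * K * C / real n < \<epsilon> / 2"
        using \<epsilon> by (intro order_tendstoD(2)[OF inv]) auto
      show "\<forall>\<^sub>F n in sequentially.
          norm (P \<tau> (Bcontfun f) - Bcontfun ((sweep (\<tau> / real n) xs ^^ n) f)) \<le> \<epsilon>"
        using 1 2 3 eventually_gt_at_top[of 0]
      proof eventually_elim
        case (elim n)
        have "norm (P \<tau> (Bcontfun f) - Bcontfun ((sweep (\<tau> / real n) xs ^^ n) f)) \<le>
            \<tau>\<^sup>2 * K * C / real n + \<tau> * F R"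
          using elim \<open>n0 \<le> R\<close> xs by (intro main[OF _ _ _ _ _ _ K_def]) auto
        with elim \<open>\<tau> * F R < \<epsilon> / 2\<close> show ?case by linarith
      qed
    qed
  qed
qed

end

lemma length_filter_concat_replicate:
  "length (filter p (concat (replicate n xs))) = n * length (filter p xs)"
  by (induction n) simp_all

lemma count_list_concat_replicate: "count_list (concat (replicate n xs)) x = n * count_list xs x"
  by (induction n) simp_all

lemma count_list_distinct: "distinct xs \<Longrightarrow> x \<in> set xs \<Longrightarrow> count_list xs x = 1"
  by (induction xs) auto

context lattice_ips
begin

lemma semigroup_insertion_bound:
  assumes \<tau>: "0 < \<tau>"
  shows "\<exists>\<delta>>0. \<forall>g a \<eta>. local_fun g \<and> (\<forall>\<eta>. 0 \<le> g \<eta>) \<and> free_of 0 g \<longrightarrow>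
    \<delta> * P \<tau> (Bcontfun g) \<eta> \<le> P \<tau> (Bcontfun (\<lambda>\<eta>. indicator {a} (\<eta> 0) * g \<eta>)) \<eta>"
proof -
  obtain \<delta>0 where \<delta>0: "0 < \<delta>0"
    "\<forall>\<^sub>F n in sequentially. \<forall>x a. \<delta>0 \<le> (spin_step (\<tau> / real n) ^^ n) (indicator {a}) x"
    using spin_pow_bounded_below[OF \<tau>] by blast
  define \<beta> where "\<beta> = ln (M / m)"
  have \<beta>: "0 \<le> \<beta>" "exp (- \<beta>) * M \<le> m"
    using m_pos m_le_M by (auto simp: \<beta>_def ln_div exp_diff exp_minus field_simps)
  define E where "E = exp (2 * \<tau> * real L * exp (\<beta> * real L + 1) * rmax)"
  define \<delta> where "\<delta> = \<delta>0 / E * exp (- (\<beta> * real L * E / \<delta>0))"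
  have \<delta>: "0 < \<delta>" using \<delta>0 by (simp add: \<delta>_def E_def)
  have "\<delta> * P \<tau> (Bcontfun g) \<eta> \<le> P \<tau> (Bcontfun (\<lambda>\<eta>. indicator {a} (\<eta> 0) * g \<eta>)) \<eta>"
    if g: "local_fun g" "\<And>\<eta>. 0 \<le> g \<eta>" "free_of 0 g" for g a \<eta>
  proof (rule field_le_epsilon)
    fix e :: real assume e: "0 < e"
    define \<epsilon> where "\<epsilon> = e / (1 + \<delta>)"
    have "\<delta> * \<epsilon> + \<epsilon> = (1 + \<delta>) * \<epsilon>" by (simp add: algebra_simps)
    then have \<epsilon>: "0 < \<epsilon>" "\<delta> * \<epsilon> + \<epsilon> = e" using e \<delta> by (auto simp: \<epsilon>_def)
    define f where "f = (\<lambda>\<eta>. indicator {a} (\<eta> 0) * g \<eta>)"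
    have f: "local_fun f"
    proof -
      obtain A where "finite A" "depends_on A g" using g(1) by (auto simp: local_fun_def)
      then have "finite (insert 0 A)" "depends_on (insert 0 A) f"
        by (auto simp: depends_on_def f_def)
      then show ?thesis unfolding local_fun_def by blast
    qed
    obtain R where R: "\<And>xs. distinct xs \<and> set xs = lattice_box 0 R \<Longrightarrow> \<forall>\<^sub>F n in sequentially.
          norm (P \<tau> (Bcontfun g) - Bcontfun ((sweep (\<tau> / real n) xs ^^ n) g)) \<le> \<epsilon>"
      "\<And>xs. distinct xs \<and> set xs = lattice_box 0 R \<Longrightarrow> \<forall>\<^sub>F n in sequentially.
          norm (P \<tau> (Bcontfun f) - Bcontfun ((sweep (\<tau> / real n) xs ^^ n) f)) \<le> \<epsilon>"
      using eventually_happens[OF eventually_conj[OF sweep_approximation[OF g(1) \<tau> \<epsilon>(1)]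
            sweep_approximation[OF f \<tau> \<epsilon>(1)]]] by auto
    obtain xs where xs: "set xs = (lattice_box 0 R :: (int ^ 'd) set)" "distinct xs"
      using finite_distinct_list[OF finite_lattice_box] by blast
    have "(\<lambda>n. \<tau> / real n * rmax) \<longlonglongrightarrow> 0 * rmax" by (intro tendsto_intros lim_const_over_n)
    then have "\<forall>\<^sub>F n in sequentially. \<tau> / real n * rmax < 1/2" by (intro order_tendstoD(2)) auto
    then obtain n where n: "norm (P \<tau> (Bcontfun g) - Bcontfun ((sweep (\<tau> / real n) xs ^^ n) g)) \<le> \<epsilon>"
      "norm (P \<tau> (Bcontfun f) - Bcontfun ((sweep (\<tau> / real n) xs ^^ n) f)) \<le> \<epsilon>"
      "\<tau> / real n * rmax \<le> 1/2" "0 < n" "\<And>x a. \<delta>0 \<le> (spin_step (\<tau> / real n) ^^ n) (indicator {a}) x"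
      using eventually_happens[OF eventually_conj[OF R(1)[of xs] eventually_conj[OF R(2)[of xs]
          eventually_conj[OF _ eventually_conj[OF eventually_gt_at_top[of 0] \<delta>0(2)]]]]] xs
      by fastforce
    define ys where "ys = concat (replicate n xs)"
    have k: "0 \<in> set ys" using n(4) xs by (auto simp: ys_def lattice_box_def)
    have visits: "real (length (filter (\<lambda>j. j \<in> lattice_box i r) ys)) * (\<tau> / real n) \<le> \<tau> * real L" for i
    proof -
      have "length (filter (\<lambda>j. j \<in> lattice_box i r) xs) = card (set xs \<inter> lattice_box i r)"
        using xs(2) by (simp add: distinct_length_filter Int_commute Int_def)
      also have "\<dots> \<le> card (lattice_box i r)" by (intro card_mono finite_lattice_box) auto
      also have "\<dots> \<le> L" by (rule card_nbh)
      finally have "\<tau> * real (length (filter (\<lambda>j. j \<in> lattice_box i r) xs)) \<le> \<tau> * real L"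
        using \<tau> by (intro mult_left_mono) auto
      then show ?thesis using n(4) by (simp add: ys_def length_filter_concat_replicate mult.commute)
    qed
    have count: "count_list ys i = n" if "i \<in> set ys" for i
      using that xs count_list_distinct[of xs i]
      by (auto simp: ys_def count_list_concat_replicate split: if_splits)
    have key: "\<delta> * sweep (\<tau> / real n) ys g \<eta> \<le> sweep (\<tau> / real n) ys f \<eta>"
      unfolding \<delta>_def f_def
      by (rule sweep_non_null[OF _ n(3) \<delta>0(1) visits count n(5) k g(2,3) \<beta> E_def]) (use \<tau> in auto)
    have loc: "local_fun (sweep (\<tau> / real n) ys u)" if u: "local_fun u" for u :: "('d, 's) config \<Rightarrow> real"
    proof -
      obtain A where "finite A" "depends_on A u" using u by (auto simp: local_fun_def)
      then have "finite (A \<union> (\<Union>i\<in>set ys. lattice_box i r))" 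
        "depends_on (A \<union> (\<Union>i\<in>set ys. lattice_box i r)) (sweep (\<tau> / real n) ys u)"
        by (auto simp: finite_lattice_box intro!: depends_on_sweep intro: depends_on_mono)
      then show ?thesis unfolding local_fun_def by blast
    qed
    have close: "\<bar>P \<tau> (Bcontfun u) \<eta> - sweep (\<tau> / real n) ys u \<eta>\<bar> \<le> \<epsilon>"
      if "local_fun u" "norm (P \<tau> (Bcontfun u) - Bcontfun ((sweep (\<tau> / real n) xs ^^ n) u)) \<le> \<epsilon>"
      for u :: "('d, 's) config \<Rightarrow> real"
      using order_trans[OF norm_bounded that(2), of \<eta>] loc[OF that(1)]
      by (simp add: apply_Bcontfun_local ys_def sweep_replicate)
    have "\<delta> * P \<tau> (Bcontfun g) \<eta> \<le> \<delta> * (sweep (\<tau> / real n) ys g \<eta> + \<epsilon>)"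
      using close[OF g(1) n(1)] \<delta> by (intro mult_left_mono) auto
    also have "\<dots> \<le> P \<tau> (Bcontfun f) \<eta> + (\<delta> * \<epsilon> + \<epsilon>)"
      using close[OF f n(2)] key by (simp add: distrib_left)
    finally show "\<delta> * P \<tau> (Bcontfun g) \<eta> \<le> P \<tau> (Bcontfun (\<lambda>\<eta>. indicator {a} (\<eta> 0) * g \<eta>)) \<eta> + e"
      by (simp add: \<epsilon>(2) f_def)
  qed
  then show ?thesis using \<delta> by blast
qed

lemma semigroup_insertion_bound_from:
  assumes \<tau>: "0 < \<tau>"
  shows "\<exists>\<delta>>0. \<forall>t\<ge>\<tau>. \<forall>g a \<eta>. local_fun g \<and> (\<forall>\<eta>. 0 \<le> g \<eta>) \<and> free_of 0 g \<longrightarrow>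
    \<delta> * P t (Bcontfun g) \<eta> \<le> P t (Bcontfun (\<lambda>\<eta>. indicator {a} (\<eta> 0) * g \<eta>)) \<eta>"
proof -
  obtain \<delta> where \<delta>: "0 < \<delta>" and "\<forall>g a \<eta>. local_fun g \<and> (\<forall>\<eta>. 0 \<le> g \<eta>) \<and> free_of 0 g \<longrightarrow>
    \<delta> * P \<tau> (Bcontfun g) \<eta> \<le> P \<tau> (Bcontfun (\<lambda>\<eta>. indicator {a} (\<eta> 0) * g \<eta>)) \<eta>"
    using semigroup_insertion_bound[OF \<tau>] by blast
  then have le: "\<delta> * P \<tau> (Bcontfun g) \<eta> \<le> P \<tau> (Bcontfun (\<lambda>\<eta>. indicator {a} (\<eta> 0) * g \<eta>)) \<eta>"
    if "local_fun g" "\<And>\<eta>. 0 \<le> g \<eta>" "free_of 0 g" for g a \<eta>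
    using that by blast
  have "\<delta> * P t (Bcontfun g) \<eta> \<le> P t (Bcontfun (\<lambda>\<eta>. indicator {a} (\<eta> 0) * g \<eta>)) \<eta>"
    if t: "\<tau> \<le> t" and g: "local_fun g" "\<And>\<eta>. 0 \<le> g \<eta>" "free_of 0 g" for t g a \<eta>
  proof -
    define f where "f = Bcontfun (\<lambda>\<eta>. indicator {a} (\<eta> 0) * g \<eta>)"
    have comp: "\<And>s t. 0 \<le> s \<Longrightarrow> 0 \<le> t \<Longrightarrow> P (s + t) = P s \<circ> P t" and lin: "linear (P (t - \<tau>))"
      and pos: "\<And>f. (\<And>\<eta>. 0 \<le> apply_bcontfun f \<eta>) \<Longrightarrow> 0 \<le> apply_bcontfun (P (t - \<tau>) f) \<eta>"
      using feller \<tau> t unfolding feller_semigroup_def by auto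
    have "P t u = P (t - \<tau>) (P \<tau> u)" for u
      using comp[of "t - \<tau>" \<tau>] \<tau> t by simp
    moreover have "0 \<le> P (t - \<tau>) (P \<tau> f - \<delta> *\<^sub>R P \<tau> (Bcontfun g)) \<eta>"
      using le[OF g] by (intro pos) (simp add: f_def)
    ultimately show ?thesis
      by (simp add: linear_diff[OF lin] linear_cmul[OF lin] f_def)
  qed
  then show ?thesis using \<delta> by blast
qed

end

lemma lattice_ips_intro:
  fixes c :: "('d::finite, 's::{finite, discrete_topology}) rates"
  assumes ti: "ti_rates c" and P: "ips_semigroup c P" and fr: "finite_range c"
    and bc: "bc_independent_reachability c" and irr: "irreducible_chain (reach_indicator c)"
  obtains r reach m M L where "lattice_ips c r reach m M L P"
proof -
  obtain r where r: "\<And>a \<eta> \<sigma>. c 0 \<eta> a = c 0 (override_on \<sigma> \<eta> (centered_box r)) a"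
    using fr unfolding finite_range_def by blast
  have box: "centered_box r = lattice_box (0 :: int ^ 'd) r"
    by (auto simp: centered_box_def lattice_box_def)
  have c_shift: "c i \<eta> b = c 0 (shift i \<eta>) b" for i \<eta> b
    using ti unfolding ti_rates_def by (metis add_0)
  have c0_nonneg: "0 \<le> c 0 \<eta> b" for \<eta> b using ti by (simp add: ti_rates_def)
  have dep: "depends_on (lattice_box 0 r) (\<lambda>\<eta>. c 0 \<eta> b)" for b
    unfolding depends_on_def
  proof (intro allI impI)
    fix \<eta> \<sigma> :: "('d, 's) config" assume "\<forall>i\<in>lattice_box 0 r. \<eta> i = \<sigma> i"
    then have "override_on \<sigma> \<eta> (centered_box r) = override_on \<sigma> \<sigma> (centered_box r)"
      by (auto simp: box override_on_def)
    then show "c 0 \<eta> b = c 0 \<sigma> b" using r[of \<eta> b \<sigma>] r[of \<sigma> b \<sigma>] by simp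
  qed
  define V where "V = (\<Union>b. range (\<lambda>\<eta>. c 0 \<eta> b))"
  have "local_fun (\<lambda>\<eta>. c 0 \<eta> b)" for b
    using dep[of b] finite_lattice_box unfolding local_fun_def by blast
  then have V: "finite V" "c 0 \<eta> b \<in> V" for \<eta> b
    by (auto simp: V_def intro!: finite_range_local)
  define m where "m = Min (insert 1 {v \<in> V. 0 < v})"
  define M where "M = Max (insert 1 V)"
  define reach where "reach = (\<lambda>x b. \<exists>\<eta>. \<eta> 0 = x \<and> 0 < c 0 \<eta> b)"
  have m: "0 < m" "m \<le> 1" unfolding m_def using V(1) by (auto simp: Min_gr_iff)
  have "1 \<le> M" unfolding M_def using V(1) by auto
  have "lattice_ips c r reach m M ((2 * r + 1) ^ CARD('d)) P"
  proof (unfold_locales)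
    show "0 < m" "m \<le> M" using m \<open>1 \<le> M\<close> by auto
    fix \<eta> :: "('d, 's) config" and i j b
    have s0: "shift i \<eta> 0 = \<eta> i" by (simp add: shift_def)
    show "c i \<eta> b = 0" if "\<not> reach (\<eta> i) b"
      using that c0_nonneg[of "shift i \<eta>" b] s0 unfolding c_shift[of i] reach_def by (metis order_le_less)
    show "m \<le> c i \<eta> b" if "reach (\<eta> i) b"
    proof -
      have "0 < c 0 (shift i \<eta>) b"
        using that s0 bc unfolding reach_def bc_independent_reachability_def by metis
      then show ?thesis
        unfolding c_shift[of i] m_def using V by (intro Min_le) auto
    qed
    show "c i \<eta> b \<le> M" unfolding c_shift[of i] M_def using V by (intro Max_ge) auto
    show "c i \<eta> b = c i \<sigma> b" if "\<And>j. j \<in> lattice_box i r \<Longrightarrow> \<eta> j = \<sigma> j" for \<sigma>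
    proof -
      have "\<forall>j\<in>lattice_box 0 r. shift i \<eta> j = shift i \<sigma> j"
        using that by (auto simp: shift_def lattice_box_def)
      then show ?thesis using dep[of b] unfolding c_shift[of i] depends_on_def by blast
    qed
    show "i \<in> lattice_box i r" by (simp add: lattice_box_def)
    show "i \<in> lattice_box j r" if "j \<in> lattice_box i r"
      using that by (auto simp: lattice_box_def abs_minus_commute)
    show "finite (lattice_box i r)" "card (lattice_box i r) \<le> (2 * r + 1) ^ CARD('d)"
      using lattice_box_card[of i r] by auto
    have "{(x, y). 0 < reach_indicator c x y} = {(x, y). reach x y}"
      by (auto simp: reach_indicator_def reach_def)
    then show "(x, y) \<in> {(x, y). reach x y}\<^sup>*" for x y
      using irr by (simp add: irreducible_chain_def)
    show "feller_semigroup P" "ips_graph c \<subseteq> semigroup_generator_graph P"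
      using P closure_subset[of "ips_graph c"] by (auto simp: ips_semigroup_def)
  qed
  then show ?thesis by (rule that)
qed

section \<open>Measures on the configuration space\<close>

lemma compact_config: "compact (UNIV :: ('v \<Rightarrow> 's::{finite, discrete_topology}) set)"
proof -
  have "compact_space (product_topology (\<lambda>_::'v. euclidean :: 's topology) UNIV)"
    unfolding compact_space_product_topology by (simp add: compact_space_def finite_imp_compact)
  then show ?thesis
    by (simp add: euclidean_product_topology compact_space_def)
qed

lemma open_contains_cylinder:
  fixes S :: "('v \<Rightarrow> 's::topological_space) set"
  assumes "open S" "\<eta> \<in> S"
  shows "\<exists>A. finite A \<and> {\<sigma>. \<forall>i\<in>A. \<sigma> i = \<eta> i} \<subseteq> S"
proof -
  obtain X where X: "\<eta> \<in> (\<Pi>\<^sub>E i\<in>UNIV. X i)" "finite {i. X i \<noteq> UNIV}" "(\<Pi>\<^sub>E i\<in>UNIV. X i) \<subseteq> S"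
    using product_topology_open_contains_basis[of "\<lambda>_. euclidean" UNIV S \<eta>] assms
    unfolding open_fun_def by auto
  have sub: "{\<sigma>. \<forall>i\<in>{i. X i \<noteq> UNIV}. \<sigma> i = \<eta> i} \<subseteq> (\<Pi>\<^sub>E i\<in>UNIV. X i)"
  proof
    fix \<sigma> assume \<sigma>: "\<sigma> \<in> {\<sigma>. \<forall>i\<in>{i. X i \<noteq> UNIV}. \<sigma> i = \<eta> i}"
    have "\<sigma> i \<in> X i" for i
      using \<sigma> X(1) by (cases "X i = UNIV") (auto simp: PiE_def Pi_def)
    then show "\<sigma> \<in> (\<Pi>\<^sub>E i\<in>UNIV. X i)" by (auto simp: PiE_iff)
  qed
  show ?thesis using X(2) subset_trans[OF sub X(3)] by (intro exI conjI)
qed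

definition local_sets :: "('v \<Rightarrow> 's) set set" where
  "local_sets = {A. local_fun (\<lambda>\<eta>. \<eta> \<in> A)}"

lemma local_fun_comp2:
  assumes "local_fun u" "local_fun w" shows "local_fun (\<lambda>\<eta>. F (u \<eta>) (w \<eta>))"
proof -
  obtain A B where "finite A" "depends_on A u" "finite B" "depends_on B w"
    using assms by (auto simp: local_fun_def)
  then have "depends_on (A \<union> B) u" "depends_on (A \<union> B) w" "finite (A \<union> B)"
    by (auto intro: depends_on_mono)
  then show ?thesis unfolding local_fun_def depends_on_def by (intro exI[of _ "A \<union> B"]) metis
qed

lemma local_fun_comp: "local_fun u \<Longrightarrow> local_fun (\<lambda>\<eta>. F (u \<eta>))"
  using local_fun_comp2[of u u "\<lambda>x _. F x"] by simp

lemma local_fun_const: "local_fun (\<lambda>_. x)"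
  unfolding local_fun_def depends_on_def by (intro exI[of _ "{}"]) auto

lemma local_fun_coordinate: "local_fun (\<lambda>\<eta>. F (\<eta> i))"
  unfolding local_fun_def depends_on_def by (intro exI[of _ "{i}"]) auto

lemma local_sets_algebra: "algebra UNIV (local_sets :: ('v \<Rightarrow> 's) set set)"
  unfolding algebra_iff_Int local_sets_def
  by (auto intro: local_fun_comp[of _ Not] local_fun_comp2[of _ _ "(\<and>)"] local_fun_const)

lemma local_sets_Int: "A \<in> local_sets \<Longrightarrow> B \<in> local_sets \<Longrightarrow> A \<inter> B \<in> local_sets"
  using local_fun_comp2[of "\<lambda>\<eta>. \<eta> \<in> A" "\<lambda>\<eta>. \<eta> \<in> B" "(\<and>)"] by (simp add: local_sets_def)

lemma UNIV_local_sets: "UNIV \<in> local_sets"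
  using local_fun_const[of True] by (simp add: local_sets_def)

lemma coordinate_local_sets: "{\<sigma>. F (\<sigma> i)} \<in> local_sets"
  using local_fun_coordinate[of F i] by (simp add: local_sets_def)

lemma local_fun_indicator: "A \<in> local_sets \<Longrightarrow> local_fun (indicator A :: _ \<Rightarrow> real)"
  using local_fun_comp[of "\<lambda>\<eta>. \<eta> \<in> A" "\<lambda>b. if b then 1 else 0 :: real"]
  by (simp add: local_sets_def indicator_def[abs_def] of_bool_def)

lemma Int_stable_local_sets: "Int_stable local_sets"
  by (auto simp: Int_stable_def local_sets_Int)

lemma open_local_sets: "A \<in> local_sets \<Longrightarrow> open (A :: ('v \<Rightarrow> 's::discrete_topology) set)"
  using open_vimage_local[of "\<lambda>\<eta>. \<eta> \<in> A" "{True}"] by (simp add: local_sets_def vimage_def)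

lemma local_sets_decseq_empty:
  fixes A :: "nat \<Rightarrow> ('v \<Rightarrow> 's::{finite, discrete_topology}) set"
  assumes A: "range A \<subseteq> local_sets" "decseq A" "(\<Inter>i. A i) = {}"
  shows "\<exists>n. A n = {}"
proof -
  have "open (- A i)" for i
    using A(1) local_fun_comp[of "\<lambda>\<eta>. \<eta> \<in> A i" Not]
    by (intro open_local_sets) (auto simp: local_sets_def)
  then obtain N where N: "finite N" "UNIV \<subseteq> (\<Union>i\<in>N. - A i)"
  proof (rule compactE_image[OF compact_config])
    show "UNIV \<subseteq> (\<Union>i. - A i)" using A(3) by blast
  qed auto
  have "A (Max (insert 0 N)) \<subseteq> A i" if "i \<in> N" for i
    using N(1) that by (intro decseqD[OF A(2)]) auto
  then have "A (Max (insert 0 N)) \<subseteq> (\<Inter>i\<in>N. A i)" by (rule INT_greatest)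
  moreover have "(\<Inter>i\<in>N. A i) = {}" using N(2) by blast
  ultimately show ?thesis by blast
qed

lemma sigma_sets_local_sets:
  "sigma_sets UNIV local_sets = sets (borel :: ('v::countable \<Rightarrow> 's::discrete_topology) measure)"
proof (intro equalityI)
  show "sigma_sets UNIV local_sets \<subseteq> sets (borel :: ('v \<Rightarrow> 's) measure)"
    using sets.sigma_sets_subset[of local_sets "borel :: ('v \<Rightarrow> 's) measure"] borel_open[OF open_local_sets]
    by auto
  have "S \<in> sigma_sets UNIV local_sets" if S: "open S" for S :: "('v \<Rightarrow> 's) set"
  proof -
    define F where "F = (\<lambda>n. {i::'v. to_nat i < n})"
    define B where "B = (\<lambda>n. {\<eta>. {\<sigma>. \<forall>i\<in>F n. \<sigma> i = \<eta> i} \<subseteq> S})"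
    have fin: "finite (F n)" for n
      unfolding F_def using finite_vimageI[of "{..<n}" "to_nat :: 'v \<Rightarrow> nat"] by (simp add: vimage_def)
    have "B n \<in> local_sets" for n
    proof -
      have "depends_on (F n) (\<lambda>\<eta>. \<eta> \<in> B n)" by (simp add: depends_on_def B_def)
      then show ?thesis using fin unfolding local_sets_def local_fun_def by blast
    qed
    moreover have "S = (\<Union>n. B n)"
    proof (intro equalityI subsetI)
      fix \<eta> assume "\<eta> \<in> S"
      then obtain A where A: "finite A" "{\<sigma>. \<forall>i\<in>A. \<sigma> i = \<eta> i} \<subseteq> S"
        using open_contains_cylinder[OF S] by blast
      have "A \<subseteq> F (Suc (Max (insert 0 (to_nat ` A))))"
        using A(1) by (auto simp: F_def less_Suc_eq_le intro!: Max_ge)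
      then have "\<eta> \<in> B (Suc (Max (insert 0 (to_nat ` A))))"
        using A(2) unfolding B_def by blast
      then show "\<eta> \<in> (\<Union>n. B n)" by blast
    qed (auto simp: B_def)
    ultimately show ?thesis by (auto intro!: sigma_sets.Union)
  qed
  then show "sets (borel :: ('v \<Rightarrow> 's) measure) \<subseteq> sigma_sets UNIV local_sets"
    unfolding borel_def by (subst sets_measure_of) (auto intro!: sigma_sets_mono)
qed

lemma local_sets_borel: "A \<in> local_sets \<Longrightarrow> A \<in> sets (borel :: ('v \<Rightarrow> 's::discrete_topology) measure)"
  by (intro borel_open open_local_sets)

lemma local_premeasure_extends:
  fixes F :: "('v::countable \<Rightarrow> 's::{finite, discrete_topology}) set \<Rightarrow> real"
  assumes nonneg: "\<And>A. A \<in> local_sets \<Longrightarrow> 0 \<le> F A"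
    and add: "\<And>A B. A \<in> local_sets \<Longrightarrow> B \<in> local_sets \<Longrightarrow> A \<inter> B = {} \<Longrightarrow> F (A \<union> B) = F A + F B"
  obtains \<mu> where "sets \<mu> = sets borel" "\<And>A. A \<in> local_sets \<Longrightarrow> emeasure \<mu> A = ennreal (F A)"
proof -
  interpret algebra UNIV "local_sets :: ('v \<Rightarrow> 's) set set" by (rule local_sets_algebra)
  have F0: "F {} = 0" using add[of "{}" "{}"] by simp
  have "\<exists>\<mu>. (\<forall>A\<in>local_sets. \<mu> A = ennreal (F A)) \<and> measure_space UNIV (sigma_sets UNIV local_sets) \<mu>"
  proof (rule caratheodory_empty_continuous)
    show "positive local_sets (\<lambda>A. ennreal (F A))" by (simp add: positive_def F0)
    show "additive local_sets (\<lambda>A. ennreal (F A))"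
      by (auto simp: additive_def add nonneg ennreal_plus)
    show "ennreal (F A) \<noteq> \<infinity>" for A by simp
    fix A :: "nat \<Rightarrow> ('v \<Rightarrow> 's) set"
    assume A: "range A \<subseteq> local_sets" "decseq A" "(\<Inter>i. A i) = {}"
    obtain n where n: "A n = {}" using local_sets_decseq_empty[OF A] by blast
    have "A k = {}" if "n \<le> k" for k using decseqD[OF A(2) that] n by auto
    then show "(\<lambda>i. ennreal (F (A i))) \<longlonglongrightarrow> 0"
      by (intro tendsto_eventually) (auto simp: eventually_sequentially F0 intro!: exI[of _ n])
  qed
  then obtain \<mu>' where \<mu>': "\<And>A. A \<in> local_sets \<Longrightarrow> \<mu>' A = ennreal (F A)"
    "measure_space UNIV (sigma_sets UNIV local_sets) \<mu>'" by blast
  define \<mu> where "\<mu> = measure_of UNIV (sigma_sets UNIV local_sets) \<mu>'"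
  have sets_\<mu>: "sets \<mu> = sigma_sets UNIV local_sets"
    unfolding \<mu>_def by (simp add: sigma_sets_sigma_sets_eq)
  have "emeasure \<mu> A = ennreal (F A)" if A: "A \<in> local_sets" for A
  proof -
    have "emeasure \<mu> A = \<mu>' A"
      unfolding \<mu>_def using \<mu>'(2) A unfolding measure_space_def
      by (intro emeasure_measure_of_sigma) auto
    then show ?thesis using \<mu>'(1) A by simp
  qed
  then show ?thesis using that[of \<mu>] sets_\<mu> by (simp add: sigma_sets_local_sets)
qed

lemma measure_eqI_local_sets:
  fixes \<mu> :: "('v::countable \<Rightarrow> 's::{finite, discrete_topology}) measure"
  assumes sets: "sets \<mu> = sets borel" "sets \<nu> = sets borel" and fin: "finite_measure \<mu>" "finite_measure \<nu>"
    and eq: "\<And>A. A \<in> local_sets \<Longrightarrow> measure \<mu> A = measure \<nu> A"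
  shows "\<mu> = \<nu>"
proof (rule measure_eqI_generator_eq[OF Int_stable_local_sets, of UNIV _ _ "\<lambda>_. UNIV"])
  interpret \<mu>: finite_measure \<mu> by fact
  interpret \<nu>: finite_measure \<nu> by fact
  show "emeasure \<mu> A = emeasure \<nu> A" if "A \<in> local_sets" for A
    using eq[OF that] by (simp add: \<mu>.emeasure_eq_measure \<nu>.emeasure_eq_measure)
  show "emeasure \<mu> UNIV \<noteq> \<infinity>" by (simp add: \<mu>.emeasure_eq_measure)
qed (use sets UNIV_local_sets in \<open>auto simp: sigma_sets_local_sets\<close>)

lemma local_approximation:
  fixes f :: "('v \<Rightarrow> 's::{finite, discrete_topology}) \<Rightarrow>\<^sub>C real"
  assumes \<epsilon>: "0 < \<epsilon>"
  obtains g where "local_fun g" "\<And>\<eta>. \<bar>f \<eta> - g \<eta>\<bar> \<le> \<epsilon>"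
proof -
  have "\<exists>A. finite A \<and> {\<sigma>. \<forall>i\<in>A. \<sigma> i = \<eta> i} \<subseteq> {\<sigma>. \<bar>f \<sigma> - f \<eta>\<bar> < \<epsilon> / 2}" for \<eta>
  proof (rule open_contains_cylinder)
    show "open {\<sigma>. \<bar>f \<sigma> - f \<eta>\<bar> < \<epsilon> / 2}"
      by (intro open_Collect_less continuous_intros continuous_on_apply_bcontfun)
  qed (use \<epsilon> in simp)
  then have "\<forall>\<eta>. \<exists>A. finite A \<and> {\<sigma>. \<forall>i\<in>A. \<sigma> i = \<eta> i} \<subseteq> {\<sigma>. \<bar>f \<sigma> - f \<eta>\<bar> < \<epsilon> / 2}" by blast
  from choice[OF this] obtain A where A: "\<And>\<eta>. finite (A \<eta>)"
    "\<And>\<eta>. {\<sigma>. \<forall>i\<in>A \<eta>. \<sigma> i = \<eta> i} \<subseteq> {\<sigma>. \<bar>f \<sigma> - f \<eta>\<bar> < \<epsilon> / 2}"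
    by blast
  obtain T where T: "finite T" "UNIV \<subseteq> (\<Union>\<eta>\<in>T. {\<sigma>. \<forall>i\<in>A \<eta>. \<sigma> i = \<eta> i})"
  proof (rule compactE_image[OF compact_config])
    show "UNIV \<subseteq> (\<Union>\<eta>. {\<sigma>. \<forall>i\<in>A \<eta>. \<sigma> i = \<eta> i})" by blast
  qed (auto intro: open_cylinder[OF A(1)])
  define W where "W = (\<Union>\<eta>\<in>T. A \<eta>)"
  define g where "g = (\<lambda>\<sigma>. f (override_on (\<lambda>_. undefined) \<sigma> W))"
  have "depends_on W g"
    unfolding depends_on_def g_def by (auto intro!: arg_cong[where f = f] simp: override_on_def)
  then have "local_fun g" using T(1) A(1) unfolding local_fun_def W_def by blast
  moreover have "\<bar>f \<sigma> - g \<sigma>\<bar> \<le> \<epsilon>" for \<sigma>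
  proof -
    obtain \<eta> where \<eta>: "\<eta> \<in> T" "\<forall>i\<in>A \<eta>. \<sigma> i = \<eta> i" using T(2) by blast
    then have "\<forall>i\<in>A \<eta>. override_on (\<lambda>_. undefined) \<sigma> W i = \<eta> i"
      by (auto simp: W_def override_on_def)
    then have "\<bar>g \<sigma> - f \<eta>\<bar> < \<epsilon> / 2" using A(2)[of \<eta>] by (auto simp: g_def)
    moreover have "\<bar>f \<sigma> - f \<eta>\<bar> < \<epsilon> / 2" using A(2)[of \<eta>] \<eta>(2) by auto
    ultimately show ?thesis by linarith
  qed
  ultimately show ?thesis by (rule that)
qed

lemma integrable_bcontfun:
  fixes f :: "('d::finite, 's::{finite, discrete_topology}) observable"
  assumes "\<mu> \<in> prob_measures"
  shows "integrable \<mu> (apply_bcontfun f)"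
proof -
  interpret prob_space \<mu> using assms by (simp add: prob_measures_def)
  have sets: "sets \<mu> = sets borel" using assms by (simp add: prob_measures_def)
  have "apply_bcontfun f \<in> borel_measurable borel"
    by (intro borel_measurable_continuous_onI continuous_on_apply_bcontfun)
  then have "apply_bcontfun f \<in> borel_measurable \<mu>" by (simp add: measurable_cong_sets[OF sets])
  then show ?thesis
    using norm_bounded[of f] by (intro integrable_const_bound[of _ "norm f"]) auto
qed

lemma integral_bcontfun_indicator:
  fixes A :: "('d::finite, 's::{finite, discrete_topology}) config set"
  assumes "\<mu> \<in> prob_measures" "A \<in> local_sets"
  shows "(\<integral>\<eta>. apply_bcontfun (Bcontfun (indicator A)) \<eta> \<partial>\<mu>) = measure \<mu> A"
proof -
  have "A \<in> sets \<mu>" "space \<mu> = UNIV"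
    using assms local_sets_borel sets_eq_imp_space_eq[of \<mu> borel] by (auto simp: prob_measures_def)
  then show ?thesis
    by (simp add: apply_Bcontfun_local[OF local_fun_indicator[OF assms(2)]])
qed

lemma local_fun_simple:
  fixes g :: "('v \<Rightarrow> 's::{finite, discrete_topology}) \<Rightarrow> real"
  assumes "local_fun g"
  shows "Bcontfun g = (\<Sum>v\<in>range g. v *\<^sub>R Bcontfun (indicator (g -` {v})))"
proof (rule bcontfun_eqI)
  fix \<eta>
  have "g -` {v} \<in> local_sets" for v
    using local_fun_comp[OF assms, of "\<lambda>x. x = v"] by (simp add: local_sets_def)
  then have ind: "apply_bcontfun (Bcontfun (indicator (g -` {v}))) = (indicator (g -` {v}) :: _ \<Rightarrow> real)" for v
    by (intro apply_Bcontfun_local local_fun_indicator)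
  have app: "apply_bcontfun (\<Sum>v\<in>V. h v) \<eta> = (\<Sum>v\<in>V. apply_bcontfun (h v) \<eta>)"
    if "finite V" for V and h :: "real \<Rightarrow> ('v \<Rightarrow> 's) \<Rightarrow>\<^sub>C real"
    using that by (induction V rule: finite_induct) auto
  have "apply_bcontfun (\<Sum>v\<in>range g. v *\<^sub>R Bcontfun (indicator (g -` {v}))) \<eta> =
      (\<Sum>v\<in>range g. if g \<eta> = v then v else 0)"
    by (subst app[OF finite_range_local[OF assms]]) (auto simp: ind indicator_def intro!: sum.cong)
  also have "\<dots> = g \<eta>" using finite_range_local[OF assms] by (simp add: sum.delta')
  finally show "apply_bcontfun (Bcontfun g) \<eta> =
      apply_bcontfun (\<Sum>v\<in>range g. v *\<^sub>R Bcontfun (indicator (g -` {v}))) \<eta>"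
    by (simp add: apply_Bcontfun_local[OF assms])
qed

lemma evolve_exists:
  fixes \<nu> :: "('d::finite, 's::{finite, discrete_topology}) config measure"
  assumes P: "feller_semigroup P" and t: "0 \<le> t" and \<nu>: "\<nu> \<in> prob_measures"
  shows "\<exists>!\<mu>. \<mu> \<in> prob_measures \<and> (\<forall>f. (\<integral>\<eta>. apply_bcontfun f \<eta> \<partial>\<mu>) = (\<integral>\<eta>. apply_bcontfun (P t f) \<eta> \<partial>\<nu>))"
proof (rule ex_ex1I)
  interpret \<nu>: prob_space \<nu> using \<nu> by (simp add: prob_measures_def)
  have lin: "linear (P t)" and one: "P t (const_bcontfun 1) = const_bcontfun 1"
    and pos: "\<And>f. (\<And>\<eta>. 0 \<le> apply_bcontfun f \<eta>) \<Longrightarrow> (\<And>\<eta>. 0 \<le> apply_bcontfun (P t f) \<eta>)"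
    using P t unfolding feller_semigroup_def by auto
  define I where "I = (\<lambda>f. \<integral>\<eta>. apply_bcontfun (P t f) \<eta> \<partial>\<nu>)"
  have I_add: "I (f + g) = I f + I g" and I_scale: "I (a *\<^sub>R f) = a * I f" for f g a
    using integrable_bcontfun[OF \<nu>] by (simp_all add: I_def linear_add[OF lin] linear_cmul[OF lin])
  have I_sum: "I (\<Sum>v\<in>V. h v) = (\<Sum>v\<in>V. I (h v))" if "finite V" for V and h :: "real \<Rightarrow> ('d, 's) observable"
    using that by (induction V rule: finite_induct) (auto simp: I_add, simp add: I_def linear_0[OF lin])
  have I_bound: "\<bar>I f\<bar> \<le> norm f" for f
  proof -
    have "\<bar>I f\<bar> \<le> (\<integral>\<eta>. norm f \<partial>\<nu>)"
      unfolding I_def using integrable_bcontfun[OF \<nu>, of "P t f"]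
        order_trans[OF norm_bounded feller_contraction[OF P t]]
      by (intro order_trans[OF integral_abs_bound integral_mono]) auto
    then show ?thesis by (simp add: \<nu>.prob_space)
  qed
  define F where "F = (\<lambda>A. I (Bcontfun (indicator A)))"
  have F_nonneg: "0 \<le> F A" if "A \<in> local_sets" for A
    unfolding F_def I_def
    by (intro integral_nonneg_AE AE_I2 pos) (simp add: apply_Bcontfun_local[OF local_fun_indicator[OF that]])
  have F_add: "F (A \<union> B) = F A + F B" if "A \<in> local_sets" "B \<in> local_sets" "A \<inter> B = {}" for A B
  proof -
    have "A \<union> B \<in> local_sets"
      using algebra.axioms(1)[OF local_sets_algebra] that by (auto dest: ring_of_sets.Un)
    then have "Bcontfun (indicator (A \<union> B)) = Bcontfun (indicator A) + (Bcontfun (indicator B) :: ('d, 's) observable)"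
      using that
      by (intro bcontfun_eqI) (auto simp: apply_Bcontfun_local local_fun_indicator indicator_def)
    then show ?thesis by (simp add: F_def I_add)
  qed
  obtain \<mu> where \<mu>: "sets \<mu> = sets borel" "\<And>A. A \<in> local_sets \<Longrightarrow> emeasure \<mu> A = ennreal (F A)"
    using local_premeasure_extends[OF F_nonneg F_add] by blast
  have "Bcontfun (indicator UNIV) = (const_bcontfun 1 :: ('d, 's) observable)"
    by (intro bcontfun_eqI, subst apply_Bcontfun_local[OF local_fun_indicator[OF UNIV_local_sets]])
      (simp add: const_bcontfun.rep_eq)
  then have "F UNIV = 1" by (simp add: F_def I_def one const_bcontfun.rep_eq \<nu>.prob_space)
  then have "prob_space \<mu>"
    using \<mu>(2)[OF UNIV_local_sets] sets_eq_imp_space_eq[OF \<mu>(1)] by (intro prob_spaceI) simp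
  then have \<mu>p: "\<mu> \<in> prob_measures" using \<mu>(1) by (simp add: prob_measures_def)
  interpret \<mu>: prob_space \<mu> by fact
  define J where "J = (\<lambda>f :: ('d, 's) observable. \<integral>\<eta>. apply_bcontfun f \<eta> \<partial>\<mu>)"
  have ind: "J (Bcontfun (indicator A)) = I (Bcontfun (indicator A))" if "A \<in> local_sets" for A
    using \<mu>(2)[OF that] F_nonneg[OF that] integral_bcontfun_indicator[OF \<mu>p that]
    by (simp add: F_def J_def measure_def)
  have J_add: "J (f + g) = J f + J g" and J_scale: "J (a *\<^sub>R f) = a * J f" for f g a
    using integrable_bcontfun[OF \<mu>p] by (simp_all add: J_def)
  have J_sum: "J (\<Sum>v\<in>V. h v) = (\<Sum>v\<in>V. J (h v))" if "finite V" for V and h :: "real \<Rightarrow> ('d, 's) observable"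
    using that by (induction V rule: finite_induct) (auto simp: J_add, simp add: J_def)
  have J_bound: "\<bar>J f\<bar> \<le> norm f" for f
  proof -
    have "\<bar>J f\<bar> \<le> (\<integral>\<eta>. norm f \<partial>\<mu>)"
      unfolding J_def using integrable_bcontfun[OF \<mu>p, of f] norm_bounded[of f]
      by (intro order_trans[OF integral_abs_bound integral_mono]) auto
    then show ?thesis by (simp add: \<mu>.prob_space)
  qed
  have local_eq: "J (Bcontfun g) = I (Bcontfun g)" if g: "local_fun g" for g :: "('d, 's) config \<Rightarrow> real"
  proof -
    have "g -` {v} \<in> local_sets" for v
      using local_fun_comp[OF g, of "\<lambda>x. x = v"] by (simp add: local_sets_def)
    then show ?thesis
      using ind finite_range_local[OF g]
      by (subst (1 2) local_fun_simple[OF g]) (simp add: J_sum I_sum J_scale I_scale)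
  qed
  have "J f = I f" for f
  proof -
    have "\<bar>J f - I f\<bar> \<le> e" if e: "0 < e" for e
    proof -
      obtain g where g: "local_fun g" "\<And>\<eta>. \<bar>f \<eta> - g \<eta>\<bar> \<le> e / 2"
        using local_approximation[of "e / 2" f] e by auto
      have "norm (f - Bcontfun g) \<le> e / 2"
        using g by (intro norm_bound) (simp add: apply_Bcontfun_local)
      then have "\<bar>J (f - Bcontfun g)\<bar> \<le> e / 2" "\<bar>I (f - Bcontfun g)\<bar> \<le> e / 2"
        using J_bound I_bound by (meson order_trans)+
      moreover have "J f = J (f - Bcontfun g) + J (Bcontfun g)" "I f = I (f - Bcontfun g) + I (Bcontfun g)"
        unfolding J_add[symmetric] I_add[symmetric] by simp_all
      ultimately show ?thesis using local_eq[OF g(1)] by linarith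
    qed
    then show ?thesis using field_le_epsilon[of "\<bar>J f - I f\<bar>" 0] by simp
  qed
  then show "\<exists>\<mu>. \<mu> \<in> prob_measures \<and> (\<forall>f. (\<integral>\<eta>. apply_bcontfun f \<eta> \<partial>\<mu>) = (\<integral>\<eta>. apply_bcontfun (P t f) \<eta> \<partial>\<nu>))"
    using \<mu>p by (auto simp: J_def I_def)
next
  fix \<mu> \<mu>'
  assume *: "\<mu> \<in> prob_measures \<and> (\<forall>f. (\<integral>\<eta>. apply_bcontfun f \<eta> \<partial>\<mu>) = (\<integral>\<eta>. apply_bcontfun (P t f) \<eta> \<partial>\<nu>))"
    "\<mu>' \<in> prob_measures \<and> (\<forall>f. (\<integral>\<eta>. apply_bcontfun f \<eta> \<partial>\<mu>') = (\<integral>\<eta>. apply_bcontfun (P t f) \<eta> \<partial>\<nu>))"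
  show "\<mu> = \<mu>'"
  proof (rule measure_eqI_local_sets)
    show "measure \<mu> A = measure \<mu>' A" if "A \<in> local_sets" for A
      using * integral_bcontfun_indicator[OF _ that] by metis
  qed (use * in \<open>auto simp: prob_measures_def prob_space_def\<close>)
qed

lemma evolve_props:
  fixes \<nu> :: "('d::finite, 's::{finite, discrete_topology}) config measure"
  assumes "feller_semigroup P" "0 \<le> t" "\<nu> \<in> prob_measures"
  shows "evolve P t \<nu> \<in> prob_measures"
    and "(\<integral>\<eta>. apply_bcontfun f \<eta> \<partial>evolve P t \<nu>) = (\<integral>\<eta>. apply_bcontfun (P t f) \<eta> \<partial>\<nu>)"
  using theI'[OF evolve_exists[OF assms]] by (auto simp: evolve_def)


lemma off_origin_sets:
  fixes A :: "('d::finite, 's::{finite, discrete_topology}) config set"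
  assumes "A \<in> sets off_origin"
  shows "A \<in> sets borel" and "\<sigma>(0 := x) \<in> A \<longleftrightarrow> \<sigma> \<in> A"
proof -
  let ?r = "\<lambda>\<sigma> :: ('d, 's) config. restrict \<sigma> (- {0})"
  have "?r \<in> UNIV \<rightarrow> space (PiM (- {0}) (\<lambda>_. borel))" by (auto simp: space_PiM)
  from assms[unfolded off_origin_def sets_vimage_algebra2[OF this]]
  obtain B where B: "A = ?r -` B" "B \<in> sets (PiM (- {0}) (\<lambda>_. borel))" by auto
  have "?r \<in> borel \<rightarrow>\<^sub>M PiM (- {0}) (\<lambda>_. borel)"
    by (intro measurable_restrict borel_measurable_continuous_onI continuous_on_product_coordinates)
  from measurable_sets[OF this B(2)] show "A \<in> sets borel" by (simp add: B(1))
  have "?r (\<sigma>(0 := x)) = ?r \<sigma>" by auto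
  then show "\<sigma>(0 := x) \<in> A \<longleftrightarrow> \<sigma> \<in> A" unfolding B(1) vimage_eq by simp
qed

lemma upd_vimage_local_sets:
  fixes A :: "('v \<Rightarrow> 's) set"
  assumes "A \<in> local_sets" shows "(\<lambda>\<sigma>. \<sigma>(i := x)) -` A \<in> local_sets"
proof -
  obtain B where B: "finite B" "depends_on B (\<lambda>\<sigma>. \<sigma> \<in> A)"
    using assms by (auto simp: local_sets_def local_fun_def)
  have "depends_on B (\<lambda>\<sigma>. \<sigma>(i := x) \<in> A)"
    unfolding depends_on_def
  proof (intro allI impI)
    fix \<eta> \<sigma> :: "'v \<Rightarrow> 's" assume "\<forall>j\<in>B. \<eta> j = \<sigma> j"
    then have "\<forall>j\<in>B. (\<eta>(i := x)) j = (\<sigma>(i := x)) j" by simp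
    then show "(\<eta>(i := x) \<in> A) = (\<sigma>(i := x) \<in> A)" using B(2) unfolding depends_on_def by blast
  qed
  then show ?thesis using B(1) by (auto simp: local_sets_def local_fun_def)
qed

text \<open>
  An inequality does not pass through the \<open>\<pi>\<close>-\<open>\<lambda>\<close> theorem. But the difference of the two sides is nonnegative
  and additive on local sets, hence extends to a measure \<open>\<rho>\<close>, and the resulting identity does pass.
\<close>

lemma insertion_bound_off_origin:
  fixes \<mu> :: "('d::finite, 's::{finite, discrete_topology}) config measure"
  assumes \<mu>: "\<mu> \<in> prob_measures"
    and le: "\<And>A. A \<in> local_sets \<Longrightarrow> (\<And>\<sigma> x. \<sigma>(0 := x) \<in> A \<longleftrightarrow> \<sigma> \<in> A) \<Longrightarrow>
      \<delta> * measure \<mu> A \<le> measure \<mu> (A \<inter> {\<sigma>. \<sigma> 0 = a})"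
    and A: "A \<in> sets off_origin"
  shows "\<delta> * measure \<mu> A \<le> measure \<mu> (A \<inter> {\<sigma>. \<sigma> 0 = a})"
proof -
  interpret prob_space \<mu> using \<mu> by (simp add: prob_measures_def)
  have sets [simp]: "sets \<mu> = sets borel" using \<mu> by (simp add: prob_measures_def)
  have space [simp]: "space \<mu> = UNIV" using sets_eq_imp_space_eq[OF sets] by simp
  define S where "S = {\<sigma> :: ('d, 's) config. \<sigma> 0 = a}"
  have S: "S \<in> sets borel"
    unfolding S_def by (intro local_sets_borel coordinate_local_sets)
  define \<pi> where "\<pi> = (\<lambda>\<sigma> :: ('d, 's) config. \<sigma>(0 := a))"
  have \<pi>_local: "\<pi> -` A \<in> local_sets" if "A \<in> local_sets" for A
    unfolding \<pi>_def by (intro upd_vimage_local_sets that)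
  define F where "F = (\<lambda>A. measure \<mu> (\<pi> -` A \<inter> S) - \<delta> * measure \<mu> (\<pi> -` A))"
  have \<pi>_borel: "\<pi> -` A \<in> sets borel" if "A \<in> sets borel" for A
  proof -
    have "\<pi> -` A \<in> sigma_sets UNIV local_sets" if "A \<in> sigma_sets UNIV local_sets" for A
      using that
    proof induction
      case (Basic A)
      then show ?case using \<pi>_local by (auto intro: sigma_sets.Basic)
    next
      case (Compl A)
      have "\<pi> -` (UNIV - A) = UNIV - \<pi> -` A" by auto
      then show ?case using Compl by (auto intro: sigma_sets.Compl)
    qed (auto simp: vimage_Union intro: sigma_sets.Empty sigma_sets.Union)
    then show ?thesis using that by (simp add: sigma_sets_local_sets)
  qed
  have F_add: "F (A \<union> B) = F A + F B" if "A \<in> sets borel" "B \<in> sets borel" "A \<inter> B = {}" for A B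
  proof -
    have d: "\<pi> -` A \<inter> \<pi> -` B = {}" using that(3) by auto
    have "measure \<mu> (\<pi> -` (A \<union> B)) = measure \<mu> (\<pi> -` A) + measure \<mu> (\<pi> -` B)"
      using that \<pi>_borel d by (simp add: finite_measure_Union)
    moreover have "measure \<mu> (\<pi> -` (A \<union> B) \<inter> S) = measure \<mu> (\<pi> -` A \<inter> S) + measure \<mu> (\<pi> -` B \<inter> S)"
      unfolding vimage_Un Int_Un_distrib2
      using that \<pi>_borel d S by (intro finite_measure_Union) auto
    ultimately show ?thesis by (simp add: F_def algebra_simps)
  qed
  have F_nonneg: "0 \<le> F A" if "A \<in> local_sets" for A
    using le[OF \<pi>_local[OF that]] by (simp add: F_def \<pi>_def S_def)
  obtain \<rho> where \<rho>: "sets \<rho> = sets borel" "\<And>A. A \<in> local_sets \<Longrightarrow> emeasure \<rho> A = ennreal (F A)"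
    using local_premeasure_extends[of F, OF F_nonneg F_add[OF local_sets_borel local_sets_borel]]
    by blast
  interpret \<rho>: finite_measure \<rho>
    using \<rho>(2)[OF UNIV_local_sets] sets_eq_imp_space_eq[OF \<rho>(1)] by (intro finite_measureI) simp
  have space_\<rho> [simp]: "space \<rho> = UNIV" using sets_eq_imp_space_eq[OF \<rho>(1)] by simp
  have eq: "measure \<rho> B = F B" if "B \<in> sets borel" for B
    using Int_stable_local_sets subset_UNIV[of local_sets, folded Pow_UNIV]
      that[folded sigma_sets_local_sets]
  proof (induction rule: sigma_sets_induct_disjoint)
    case (basic A)
    then show ?case using \<rho>(2) F_nonneg by (simp add: measure_def)
  next
    case empty
    then show ?case by (simp add: F_def)
  next
    case (compl A)
    have A: "A \<in> sets borel" using compl(1) by (simp add: sigma_sets_local_sets)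
    have "measure \<rho> UNIV = F UNIV"
      using \<rho>(2)[OF UNIV_local_sets] F_nonneg[OF UNIV_local_sets] by (simp add: measure_def)
    moreover have "F UNIV = F A + F (UNIV - A)"
      using F_add[of A "UNIV - A"] A by simp
    moreover have "measure \<rho> (UNIV - A) = measure \<rho> UNIV - measure \<rho> A"
      using \<rho>.finite_measure_compl[of A] A \<rho>(1) by simp
    ultimately show ?case using compl(2) by simp
  next
    case (union B)
    have B: "range B \<subseteq> sets borel" using union(2) by (simp add: sigma_sets_local_sets)
    have d: "disjoint_family (\<lambda>i. \<pi> -` B i)" "disjoint_family (\<lambda>i. \<pi> -` B i \<inter> S)"
      using union(1) by (auto simp: disjoint_family_on_def)
    have "(\<lambda>i. measure \<mu> (\<pi> -` B i \<inter> S) - \<delta> * measure \<mu> (\<pi> -` B i)) sums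
        (measure \<mu> (\<Union>i. \<pi> -` B i \<inter> S) - \<delta> * measure \<mu> (\<Union>i. \<pi> -` B i))"
      using B \<pi>_borel S d by (intro sums_diff sums_mult finite_measure_UNION) auto
    moreover have "(\<Union>i. \<pi> -` B i \<inter> S) = \<pi> -` (\<Union>i. B i) \<inter> S" "(\<Union>i. \<pi> -` B i) = \<pi> -` (\<Union>i. B i)"
      by auto
    ultimately have "(\<lambda>i. F (B i)) sums F (\<Union>i. B i)" by (simp add: F_def)
    moreover have "(\<lambda>i. measure \<rho> (B i)) sums measure \<rho> (\<Union>i. B i)"
      using B \<rho>(1) union(1) by (intro \<rho>.finite_measure_UNION) auto
    ultimately show ?case using union(3) by (simp add: sums_unique2)
  qed
  have "\<pi> -` A = A" using off_origin_sets(2)[OF A] by (auto simp: \<pi>_def)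
  then show ?thesis
    using eq[OF off_origin_sets(1)[OF A]] measure_nonneg[of \<rho> A] by (simp add: F_def S_def)
qed

lemma non_nullI:
  fixes \<mu> :: "('d::finite, 's::{finite, discrete_topology}) config measure"
  assumes \<mu>: "\<mu> \<in> prob_measures" and \<delta>: "0 < \<delta>"
    and le: "\<And>a A. A \<in> local_sets \<Longrightarrow> (\<And>\<sigma> x. \<sigma>(0 := x) \<in> A \<longleftrightarrow> \<sigma> \<in> A) \<Longrightarrow>
      \<delta> * measure \<mu> A \<le> measure \<mu> (A \<inter> {\<sigma>. \<sigma> 0 = a})"
  shows "non_null \<delta> \<mu>"
proof -
  interpret prob_space \<mu> using \<mu> by (simp add: prob_measures_def)
  have sets [simp]: "sets \<mu> = sets borel" using \<mu> by (simp add: prob_measures_def)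
  have space [simp]: "space \<mu> = UNIV" using sets_eq_imp_space_eq[OF sets] by simp
  have space_off [simp]: "space off_origin = (UNIV :: ('d, 's) config set)" by (simp add: off_origin_def)
  have sub: "subalgebra \<mu> off_origin"
    using off_origin_sets(1) by (auto simp: subalgebra_def)
  interpret finite_measure_subalgebra \<mu> off_origin
    by unfold_locales (rule sub)
  define S where "S = (\<lambda>a. {\<sigma> :: ('d, 's) config. \<sigma> 0 = a})"
  have S: "S a \<in> sets \<mu>" for a
    unfolding S_def sets by (intro local_sets_borel coordinate_local_sets)
  define X where "X = (\<lambda>a. real_cond_exp \<mu> off_origin (indicator (S a)))"
  have X_meas [measurable]: "X a \<in> borel_measurable off_origin" for a by (simp add: X_def)
  have int: "integrable \<mu> (indicator (S a) :: _ \<Rightarrow> real)" for a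
    using S by (simp add: emeasure_eq_measure)
  have X_int: "integrable \<mu> (X a)" for a unfolding X_def by (intro real_cond_exp_int int)
  have X_ge: "AE \<sigma> in \<mu>. \<delta> \<le> X a \<sigma>" for a
  proof -
    let ?R = "restr_to_subalg \<mu> off_origin"
    interpret R: prob_space ?R by (rule prob_space_restr_to_subalg[OF sub prob_space_axioms])
    have meas: "(\<lambda>\<sigma>. X a \<sigma> - \<delta>) \<in> borel_measurable off_origin" by measurable
    have "AE \<sigma> in ?R. 0 \<le> X a \<sigma> - \<delta>"
    proof (rule R.density_nonneg)
      show "integrable ?R (\<lambda>\<sigma>. X a \<sigma> - \<delta>)"
        using X_int by (intro integrable_in_subalg[OF sub meas]) simp
      fix A assume "A \<in> sets ?R"
      then have A: "A \<in> sets off_origin" by (simp add: sets_restr_to_subalg[OF sub])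
      then have A': "A \<in> sets \<mu>" using off_origin_sets(1) by simp
      have "set_lebesgue_integral ?R A (\<lambda>\<sigma>. X a \<sigma> - \<delta>) = (\<integral>\<sigma>\<in>A. X a \<sigma> - \<delta> \<partial>\<mu>)"
        unfolding set_lebesgue_integral_def
        using A meas by (intro integral_subalgebra2[OF sub] borel_measurable_scaleR borel_measurable_indicator)
      also have "\<dots> = (\<integral>\<sigma>\<in>A. X a \<sigma> \<partial>\<mu>) - (\<integral>\<sigma>\<in>A. \<delta> \<partial>\<mu>)"
        using A' X_int integrable_mult_indicator[OF A' X_int]
        by (intro set_integral_diff) (auto simp: set_integrable_def emeasure_eq_measure)
      also have "(\<integral>\<sigma>\<in>A. X a \<sigma> \<partial>\<mu>) = (\<integral>\<sigma>\<in>A. indicator (S a) \<sigma> \<partial>\<mu>)"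
        unfolding X_def by (rule real_cond_exp_intA[OF int A, symmetric])
      also have "\<dots> = measure \<mu> (A \<inter> S a)"
        using A' S by (simp add: set_lebesgue_integral_def indicator_inter_arith[symmetric])
      also have "(\<integral>\<sigma>\<in>A. \<delta> \<partial>\<mu>) = \<delta> * measure \<mu> A"
        using A' by (simp add: set_lebesgue_integral_def)
      finally show "0 \<le> set_lebesgue_integral ?R A (\<lambda>\<sigma>. X a \<sigma> - \<delta>)"
        using insertion_bound_off_origin[OF \<mu> le A, of a] by (simp add: S_def)
    qed
    then show ?thesis using AE_restr_to_subalg[OF sub] by simp
  qed
  have X_sum: "AE \<sigma> in \<mu>. (\<Sum>a\<in>UNIV. X a \<sigma>) = 1"
  proof -
    have "(\<Sum>a\<in>UNIV. indicator (S a) \<sigma>) = (1 :: real)" for \<sigma>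
      by (simp add: S_def indicator_def of_bool_def)
    then have "AE \<sigma> in \<mu>. real_cond_exp \<mu> off_origin (\<lambda>_. 1) \<sigma> = (\<Sum>a\<in>UNIV. X a \<sigma>)"
      using real_cond_exp_sum[of "\<lambda>a. indicator (S a)" UNIV, OF int] by (simp add: X_def)
    moreover have "AE \<sigma> in \<mu>. real_cond_exp \<mu> off_origin (\<lambda>_. 1) \<sigma> = 1"
      by (intro real_cond_exp_F_meas) auto
    ultimately show ?thesis by eventually_elim simp
  qed
  define good where "good = (\<lambda>\<sigma>. (\<forall>a. 0 \<le> X a \<sigma>) \<and> (\<Sum>a\<in>UNIV. X a \<sigma>) = 1)"
  define \<kappa> where "\<kappa> = (\<lambda>\<sigma>. if good \<sigma> then embed_pmf (\<lambda>a. X a \<sigma>) else return_pmf undefined)"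
  have pmf_good: "pmf (\<kappa> \<sigma>) a = X a \<sigma>" if "good \<sigma>" for \<sigma> a
  proof -
    have "(\<integral>\<^sup>+a. ennreal (X a \<sigma>) \<partial>count_space UNIV) = (\<Sum>a\<in>UNIV. ennreal (X a \<sigma>))"
      by (simp add: nn_integral_count_space_finite)
    also have "\<dots> = 1" using that by (simp add: good_def)
    finally show ?thesis using that by (simp add: \<kappa>_def good_def pmf_embed_pmf)
  qed
  have "(\<lambda>\<sigma>. pmf (\<kappa> \<sigma>) a) = (\<lambda>\<sigma>. if good \<sigma> then X a \<sigma> else pmf (return_pmf undefined) a)" for a
    using pmf_good by (auto simp: \<kappa>_def)
  moreover have "Measurable.pred off_origin good" unfolding good_def by measurable
  ultimately have meas: "(\<lambda>\<sigma>. pmf (\<kappa> \<sigma>) a) \<in> borel_measurable off_origin" for a by simp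
  have "AE \<sigma> in \<mu>. \<forall>a. \<delta> \<le> X a \<sigma>" using X_ge by (simp add: AE_all_countable)
  then have AE_good: "AE \<sigma> in \<mu>. good \<sigma> \<and> (\<forall>a. \<delta> \<le> X a \<sigma>)"
    using X_sum by eventually_elim (use \<delta> in \<open>auto simp: good_def intro: order_trans less_imp_le\<close>)
  have "single_site_version \<mu> \<kappa>"
    unfolding single_site_version_def
  proof (intro allI conjI meas)
    show "AE \<sigma> in \<mu>. pmf (\<kappa> \<sigma>) a = real_cond_exp \<mu> off_origin (indicator {\<sigma>. \<sigma> 0 = a}) \<sigma>" for a
      using AE_good by eventually_elim (simp add: pmf_good, simp add: X_def S_def)
  qed
  moreover have "AE \<sigma> in \<mu>. \<delta> \<le> pmf (\<kappa> \<sigma>) a" for a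
    using AE_good by eventually_elim (simp add: pmf_good)
  ultimately show ?thesis using \<mu> \<delta> unfolding non_null_def by blast
qed

theorem proposition2p7:
  fixes c :: "('d::finite, 's::{finite, discrete_topology}) rates"
    and P :: "real \<Rightarrow> ('d, 's) observable \<Rightarrow> ('d, 's) observable"
  assumes "ti_rates c"
    and "ips_semigroup c P"
    and "finite_range c"
    and "bc_independent_reachability c"
    and "irreducible_chain (reach_indicator c)"
  shows "\<forall>\<tau>>0. \<exists>\<delta>>0. \<forall>\<nu>\<in>ti_measures.
           (\<forall>t\<ge>\<tau>. non_null \<delta> (evolve P t \<nu>)) \<and>
           (\<forall>t \<nu>'. (\<forall>n. 0 \<le> t n) \<and> incseq t \<and> filterlim t at_top sequentially \<and>
              \<nu>' \<in> prob_measures \<and> weak_limit (\<lambda>n. evolve P (t n) \<nu>) \<nu>' \<longrightarrow> non_null \<delta> \<nu>')"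
proof (intro allI impI)
  fix \<tau> :: real assume \<tau>: "0 < \<tau>"
  obtain r reach m M L where "lattice_ips c r reach m M L P"
    using lattice_ips_intro[OF assms] by blast
  then interpret lattice_ips c r reach m M L P .
  obtain \<delta> where \<delta>: "0 < \<delta>" and bound: "\<forall>t\<ge>\<tau>. \<forall>g a \<eta>. local_fun g \<and> (\<forall>\<eta>. 0 \<le> g \<eta>) \<and> free_of 0 g \<longrightarrow>
    \<delta> * P t (Bcontfun g) \<eta> \<le> P t (Bcontfun (\<lambda>\<eta>. indicator {a} (\<eta> 0) * g \<eta>)) \<eta>"
    using semigroup_insertion_bound_from[OF \<tau>] by blast
  have int_bound: "\<delta> * measure (evolve P t \<nu>) A \<le> measure (evolve P t \<nu>) (A \<inter> {\<sigma>. \<sigma> 0 = a})"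
    if \<nu>: "\<nu> \<in> ti_measures" and t: "\<tau> \<le> t"
      and A: "A \<in> local_sets" "\<And>\<sigma> x. \<sigma>(0 := x) \<in> A \<longleftrightarrow> \<sigma> \<in> A" for \<nu> t A a
  proof -
    have \<nu>p: "\<nu> \<in> prob_measures" using \<nu> by (simp add: ti_measures_def)
    have t0: "0 \<le> t" using t \<tau> by simp
    note ev = evolve_props[OF feller t0 \<nu>p]
    have A': "A \<inter> {\<sigma>. \<sigma> 0 = a} \<in> local_sets" by (intro local_sets_Int A coordinate_local_sets)
    have ind: "(\<lambda>\<eta>. indicator {a} (\<eta> 0) * indicator A \<eta>) = (indicator (A \<inter> {\<sigma>. \<sigma> 0 = a}) :: _ \<Rightarrow> real)"
      by (auto simp: indicator_def)
    have "local_fun (indicator A :: _ \<Rightarrow> real)" "free_of 0 (indicator A :: _ \<Rightarrow> real)"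
      using A local_fun_indicator by (auto simp: free_of_def indicator_def)
    then have pw: "\<delta> * P t (Bcontfun (indicator A)) \<eta> \<le> P t (Bcontfun (indicator (A \<inter> {\<sigma>. \<sigma> 0 = a}))) \<eta>" for \<eta>
      using bound[rule_format, where t = t and g = "indicator A" and a = a and \<eta> = \<eta>] t by (simp add: ind)
    have "\<delta> * measure (evolve P t \<nu>) A = (\<integral>\<eta>. \<delta> * apply_bcontfun (P t (Bcontfun (indicator A))) \<eta> \<partial>\<nu>)"
      using integral_bcontfun_indicator[OF ev(1) A(1)] ev(2) by simp
    also have "\<dots> \<le> (\<integral>\<eta>. apply_bcontfun (P t (Bcontfun (indicator (A \<inter> {\<sigma>. \<sigma> 0 = a})))) \<eta> \<partial>\<nu>)"
      using pw integrable_bcontfun[OF \<nu>p] by (intro integral_mono) auto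
    also have "\<dots> = measure (evolve P t \<nu>) (A \<inter> {\<sigma>. \<sigma> 0 = a})"
      using integral_bcontfun_indicator[OF ev(1) A'] ev(2) by simp
    finally show ?thesis .
  qed
  show "\<exists>\<delta>>0. \<forall>\<nu>\<in>ti_measures. (\<forall>t\<ge>\<tau>. non_null \<delta> (evolve P t \<nu>)) \<and>
     (\<forall>t \<nu>'. (\<forall>n. 0 \<le> t n) \<and> incseq t \<and> filterlim t at_top sequentially \<and>
        \<nu>' \<in> prob_measures \<and> weak_limit (\<lambda>n. evolve P (t n) \<nu>) \<nu>' \<longrightarrow> non_null \<delta> \<nu>')"
  proof (intro exI[of _ \<delta>] conjI ballI allI impI \<delta>)
    fix \<nu> :: "('d, 's) config measure" assume \<nu>: "\<nu> \<in> ti_measures"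
    then have \<nu>p: "\<nu> \<in> prob_measures" by (simp add: ti_measures_def)
    show "non_null \<delta> (evolve P t \<nu>)" if t: "\<tau> \<le> t" for t
      using \<tau> t by (intro non_nullI \<delta> int_bound[OF \<nu> t] evolve_props(1)[OF feller _ \<nu>p]) auto
    fix t \<nu>'
    assume *: "(\<forall>n. 0 \<le> t n) \<and> incseq t \<and> filterlim t at_top sequentially \<and>
        \<nu>' \<in> prob_measures \<and> weak_limit (\<lambda>n. evolve P (t n) \<nu>) \<nu>'"
    then have \<nu>': "\<nu>' \<in> prob_measures" by blast
    have lim: "(\<lambda>n. measure (evolve P (t n) \<nu>) A) \<longlonglongrightarrow> measure \<nu>' A" if A: "A \<in> local_sets" for A
    proof -
      have "(\<lambda>n. \<integral>\<eta>. apply_bcontfun (Bcontfun (indicator A :: _ \<Rightarrow> real)) \<eta> \<partial>evolve P (t n) \<nu>) \<longlonglongrightarrow>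
          (\<integral>\<eta>. apply_bcontfun (Bcontfun (indicator A :: _ \<Rightarrow> real)) \<eta> \<partial>\<nu>')"
        using * unfolding weak_limit_def by blast
      moreover have "evolve P (t n) \<nu> \<in> prob_measures" for n
        using * by (intro evolve_props(1)[OF feller _ \<nu>p]) auto
      ultimately show ?thesis
        using integral_bcontfun_indicator[OF _ A] \<nu>' by simp
    qed
    show "non_null \<delta> \<nu>'"
    proof (rule non_nullI[OF \<nu>' \<delta>])
      fix a and A :: "('d, 's) config set"
      assume A: "A \<in> local_sets" "\<And>\<sigma> x. \<sigma>(0 := x) \<in> A \<longleftrightarrow> \<sigma> \<in> A"
      have "\<forall>\<^sub>F n in sequentially. \<tau> \<le> t n" using * by (simp add: filterlim_at_top)
      then have "\<forall>\<^sub>F n in sequentially. \<delta> * measure (evolve P (t n) \<nu>) A \<le>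
          measure (evolve P (t n) \<nu>) (A \<inter> {\<sigma>. \<sigma> 0 = a})"
        by eventually_elim (intro int_bound[OF \<nu> _ A])
      then show "\<delta> * measure \<nu>' A \<le> measure \<nu>' (A \<inter> {\<sigma>. \<sigma> 0 = a})"
        by (intro tendsto_le[OF sequentially_bot lim tendsto_mult_left[OF lim]] local_sets_Int
            coordinate_local_sets A)
    qed
  qed
qed

end
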